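(* The noncommutative Faà di Bruno bialgebra $\mathcal F^{\mathrm{nc}}$ is isomorphic to the homotopy cardinality of the incidence bialgebra of the simplicial groupoid $\mathcal B^{\mathsf M^{\mathrm r}}\mathsf{Ass}$.
   Context: Monads and operads. $\mathbf{Grpd}$ is the category of groupoids. $\mathsf{M}^{\mathrm r}$ is the monad on $\mathbf{Grpd}$ sending $A$ to $\bigsqcup_{n\ge 1}A^n$ (nonempty tuples, morphisms componentwise), unit $a\mapsto (a)$, multiplication $\mu$ concatenation. An $\mathsf M^{\mathrm r}$-operad $Q$ consists of groupoids $Q_0$ (colours), $Q_1$ (operations), functors $s\colon Q_1\to\mathsf M^{\mathrm r}Q_0$ (inputs), $t\colon Q_1\to Q_0$ (output), composition $m\colon\mathsf M^{\mathrm r}Q_1\times_{\mathsf M^{\mathrm r}Q_0}Q_1\to Q_1$ (the $Q_1$ factor being the root) and units, with the usual laws. $\mathsf{Ass}$ is the terminal $\mathsf M^{\mathrm r}$-operad on one colour: $Q_0=1$, $Q_1=\mathsf M^{\mathrm r}1$ (discrete; one $n$-ary operation for each $n\ge1$), composition given by $\mu$. Bar construction. For an $\mathsf M^{\mathrm r}$-operad $Q$ put $Q_n:=\mathsf M^{\mathrm r}Q_{n-1}\times_{\mathsf M^{\mathrm r}Q_0}Q_1$ ($n\ge2$; $n$-level trees). $\mathcal B^{\mathsf M^{\mathrm r}}Q$ is the simplicial groupoid with $n$-simplices $\mathsf M^{\mathrm r}Q_n$ (ordered sequences of $n$-level trees); $d_0$ discards the top (leafward) level keeping outputs, $d_n$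 discards the root level and flattens via $\mu$, inner faces compose adjacent levels via $m$, degeneracies insert units. Incidence bialgebra. $|G|=\sum_{[x]}1/|\mathrm{Aut}(x)|$. For $X=\mathcal B^{\mathsf M^{\mathrm r}}Q$, $\mathbb Q_{\pi_0X_1}$ has basis $\delta_a$; $\Delta(\delta_f)=\sum_{a,b}\frac{|\Phi_{f;a,b}|}{|\mathrm{Aut}(a)||\mathrm{Aut}(b)|}\delta_a\otimes\delta_b$ with $\Phi_{f;a,b}$ the homotopy fibre over $(a,b)$ of $(d_2,d_0)$ restricted to the homotopy fibre of $d_1\colon X_2\to X_1$ over $f$; $\epsilon(\delta_f)=$ cardinality of the homotopy fibre of $s_0$ over $f$; product $\delta_a\delta_b=\delta_{a+b}$ by concatenation of sequences (unit adjoined). The bialgebra. Let $R$ be a noncommutative unital ring and write power series in one variable $x$ without constant term with coefficients in $R$ as $F=\sum_{n\ge1}f_nx^n$. $\mathcal F^{\mathrm{nc}}$ is the free associative unital algebra $\mathbb Q\langle a_1,a_2,\dots\rangle$ on the maps $a_n(F)=f_n$, with comultiplication induced by substitution of power series ($\Delta(a_n)(F,G)=a_n(G\circ F)$) and counit $\epsilon(a_n)=a_n(x)$. *)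

theory Defs
  imports
    "HOL-Library.Poly_Mapping"
    "HOL-Library.Product_Plus"
    "HOL-Computational_Algebra.Formal_Power_Series"
begin

section \<open>Groupoids and functors\<close>

record ('o, 'a) grpd =
  Obj :: "'o set"
  Arr :: "'a set"
  Dom :: "'a \<Rightarrow> 'o"
  Cod :: "'a \<Rightarrow> 'o"
  Ide :: "'o \<Rightarrow> 'a"
  Cmp :: "'a \<Rightarrow> 'a \<Rightarrow> 'a"  \<comment> \<open>\<open>Cmp G g f\<close> is \<open>g\<close> after \<open>f\<close>\<close>

locale groupoid =
  fixes G :: "('o, 'a) grpd"
  assumes Dom_closed: "f \<in> Arr G \<Longrightarrow> Dom G f \<in> Obj G"
    and Cod_closed: "f \<in> Arr G \<Longrightarrow> Cod G f \<in> Obj G"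
    and Ide_closed: "x \<in> Obj G \<Longrightarrow> Ide G x \<in> Arr G \<and> Dom G (Ide G x) = x \<and> Cod G (Ide G x) = x"
    and Cmp_closed: "\<lbrakk>f \<in> Arr G; g \<in> Arr G; Cod G f = Dom G g\<rbrakk> \<Longrightarrow>
          Cmp G g f \<in> Arr G \<and> Dom G (Cmp G g f) = Dom G f \<and> Cod G (Cmp G g f) = Cod G g"
    and Cmp_Ide: "f \<in> Arr G \<Longrightarrow> Cmp G f (Ide G (Dom G f)) = f \<and> Cmp G (Ide G (Cod G f)) f = f"
    and Cmp_assoc: "\<lbrakk>f \<in> Arr G; g \<in> Arr G; h \<in> Arr G; Cod G f = Dom G g; Cod G g = Dom G h\<rbrakk> \<Longrightarrow>
          Cmp G h (Cmp G g f) = Cmp G (Cmp G h g) f"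
    and inverse: "f \<in> Arr G \<Longrightarrow> \<exists>g \<in> Arr G. Dom G g = Cod G f \<and> Cod G g = Dom G f \<and>
          Cmp G g f = Ide G (Dom G f) \<and> Cmp G f g = Ide G (Cod G f)"

record ('o, 'a, 'p, 'b) fnctor =
  on_obj :: "'o \<Rightarrow> 'p"
  on_arr :: "'a \<Rightarrow> 'b"

definition is_functor :: "('o, 'a) grpd \<Rightarrow> ('p, 'b) grpd \<Rightarrow> ('o, 'a, 'p, 'b) fnctor \<Rightarrow> bool" where
  "is_functor G H F \<longleftrightarrow>
     (\<forall>x \<in> Obj G. on_obj F x \<in> Obj H \<and> on_arr F (Ide G x) = Ide H (on_obj F x)) \<and>
     (\<forall>f \<in> Arr G. on_arr F f \<in> Arr H \<and>
        Dom H (on_arr F f) = on_obj F (Dom G f) \<and> Cod H (on_arr F f) = on_obj F (Cod G f)) \<and>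
     (\<forall>f \<in> Arr G. \<forall>g \<in> Arr G. Cod G f = Dom G g \<longrightarrow>
        on_arr F (Cmp G g f) = Cmp H (on_arr F g) (on_arr F f))"

definition one_grpd :: "(unit, unit) grpd" where
  "one_grpd = \<lparr>Obj = {()}, Arr = {()}, Dom = id, Cod = id, Ide = id, Cmp = (\<lambda>_ _. ())\<rparr>"

definition prod_grpd :: "('o, 'a) grpd \<Rightarrow> ('p, 'b) grpd \<Rightarrow> ('o \<times> 'p, 'a \<times> 'b) grpd" where
  "prod_grpd G H = \<lparr>Obj = Obj G \<times> Obj H, Arr = Arr G \<times> Arr H,
     Dom = map_prod (Dom G) (Dom H), Cod = map_prod (Cod G) (Cod H),
     Ide = map_prod (Ide G) (Ide H),
     Cmp = (\<lambda>(g, h) (g', h'). (Cmp G g g', Cmp H h h'))\<rparr>"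

definition pullback_grpd :: "('o, 'a) grpd \<Rightarrow> ('o, 'a, 'r, 'c) fnctor \<Rightarrow>
    ('p, 'b, 'r, 'c) fnctor \<Rightarrow> ('p, 'b) grpd \<Rightarrow> ('o \<times> 'p, 'a \<times> 'b) grpd" where
  "pullback_grpd G F K H = (prod_grpd G H)
     \<lparr>Obj := {(x, y). x \<in> Obj G \<and> y \<in> Obj H \<and> on_obj F x = on_obj K y},
      Arr := {(f, g). f \<in> Arr G \<and> g \<in> Arr H \<and> on_arr F f = on_arr K g}\<rparr>"

text \<open>The copy of \<open>G\<close> along injections \<open>f\<close> on objects and \<open>h\<close> on arrows, with left inverses
  \<open>f'\<close> and \<open>h'\<close>.\<close>
definition relabel :: "('o \<Rightarrow> 'p) \<Rightarrow> ('p \<Rightarrow> 'o) \<Rightarrow> ('a \<Rightarrow> 'b) \<Rightarrow> ('b \<Rightarrow> 'a) \<Rightarrow>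
    ('o, 'a) grpd \<Rightarrow> ('p, 'b) grpd" where
  "relabel f f' h h' G = \<lparr>Obj = f ` Obj G, Arr = h ` Arr G,
     Dom = (\<lambda>a. f (Dom G (h' a))), Cod = (\<lambda>a. f (Cod G (h' a))),
     Ide = (\<lambda>x. h (Ide G (f' x))), Cmp = (\<lambda>b a. h (Cmp G (h' b) (h' a)))\<rparr>"


section \<open>The monad of nonempty tuples and its operads\<close>

definition Mr :: "('o, 'a) grpd \<Rightarrow> ('o list, 'a list) grpd" where
  "Mr G = \<lparr>Obj = {xs. xs \<noteq> [] \<and> set xs \<subseteq> Obj G}, Arr = {fs. fs \<noteq> [] \<and> set fs \<subseteq> Arr G},
     Dom = map (Dom G), Cod = map (Cod G), Ide = map (Ide G), Cmp = map2 (Cmp G)\<rparr>"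

definition Mr_map :: "('o, 'a, 'p, 'b) fnctor \<Rightarrow> ('o list, 'a list, 'p list, 'b list) fnctor" where
  "Mr_map F = \<lparr>on_obj = map (on_obj F), on_arr = map (on_arr F)\<rparr>"

definition Mr_unit :: "('o, 'a, 'o list, 'a list) fnctor" where
  "Mr_unit = \<lparr>on_obj = (\<lambda>x. [x]), on_arr = (\<lambda>f. [f])\<rparr>"

definition Mr_mult :: "('o list list, 'a list list, 'o list, 'a list) fnctor" where
  "Mr_mult = \<lparr>on_obj = concat, on_arr = concat\<rparr>"

record ('c, 'd, 'o, 'a) Mr_operad =
  colours :: "('c, 'd) grpd"
  opers :: "('o, 'a) grpd"
  src :: "('o, 'a, 'c list, 'd list) fnctor"
  tgt :: "('o, 'a, 'c, 'd) fnctor"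
  cmpn :: "('o list \<times> 'o, 'a list \<times> 'a, 'o, 'a) fnctor"
  unt :: "('c, 'd, 'o, 'a) fnctor"

text \<open>The equational laws, for the underlying sets \<open>C\<close> and \<open>P\<close> of either the objects or the arrows.\<close>
definition operad_laws :: "'c set \<Rightarrow> 'o set \<Rightarrow> ('o \<Rightarrow> 'c list) \<Rightarrow> ('o \<Rightarrow> 'c) \<Rightarrow>
    ('o list \<times> 'o \<Rightarrow> 'o) \<Rightarrow> ('c \<Rightarrow> 'o) \<Rightarrow> bool" where
  "operad_laws C P s t m u \<longleftrightarrow>
     (\<forall>c \<in> C. s (u c) = [c] \<and> t (u c) = c) \<and>
     (\<forall>r \<in> P. m (map u (s r), r) = r \<and> m ([r], u (t r)) = r) \<and>
     (\<forall>xs r. set xs \<subseteq> P \<and> r \<in> P \<and> map t xs = s r \<longrightarrow>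
        s (m (xs, r)) = concat (map s xs) \<and> t (m (xs, r)) = t r) \<and>
     (\<forall>yss xs r. (\<forall>ys \<in> set yss. set ys \<subseteq> P) \<and> set xs \<subseteq> P \<and> r \<in> P \<and>
        map (map t) yss = map s xs \<and> map t xs = s r \<longrightarrow>
        m (concat yss, m (xs, r)) = m (map m (zip yss xs), r))"

definition is_Mr_operad :: "('c, 'd, 'o, 'a) Mr_operad \<Rightarrow> bool" where
  "is_Mr_operad Q \<longleftrightarrow>
     groupoid (colours Q) \<and> groupoid (opers Q) \<and>
     is_functor (opers Q) (Mr (colours Q)) (src Q) \<and>
     is_functor (opers Q) (colours Q) (tgt Q) \<and>
     is_functor (pullback_grpd (Mr (opers Q)) (Mr_map (tgt Q)) (src Q) (opers Q)) (opers Q) (cmpn Q) \<and>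
     is_functor (colours Q) (opers Q) (unt Q) \<and>
     operad_laws (Obj (colours Q)) (Obj (opers Q)) (on_obj (src Q)) (on_obj (tgt Q))
       (on_obj (cmpn Q)) (on_obj (unt Q)) \<and>
     operad_laws (Arr (colours Q)) (Arr (opers Q)) (on_arr (src Q)) (on_arr (tgt Q))
       (on_arr (cmpn Q)) (on_arr (unt Q))"

definition Ass :: "(unit, unit, unit list, unit list) Mr_operad" where
  "Ass = \<lparr>colours = one_grpd, opers = Mr one_grpd,
     src = \<lparr>on_obj = id, on_arr = id\<rparr>,
     tgt = \<lparr>on_obj = (\<lambda>_. ()), on_arr = (\<lambda>_. ())\<rparr>,
     cmpn = (let \<mu> = (Mr_mult :: (unit list list, unit list list, unit list, unit list) fnctor) in
       \<lparr>on_obj = (\<lambda>(xs, _). on_obj \<mu> xs), on_arr = (\<lambda>(fs, _). on_arr \<mu> fs)\<rparr>),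
     unt = Mr_unit\<rparr>"

lemma groupoid_Mr:
  assumes "groupoid G"
  shows "groupoid (Mr G)"
proof -
  interpret groupoid G by fact
  show ?thesis
  proof
    fix fs gs assume *: "fs \<in> Arr (Mr G)" "gs \<in> Arr (Mr G)" "Cod (Mr G) fs = Dom (Mr G) gs"
    then have "length fs = length gs" by (auto simp: Mr_def dest: map_eq_imp_length_eq)
    then show "Cmp (Mr G) gs fs \<in> Arr (Mr G) \<and> Dom (Mr G) (Cmp (Mr G) gs fs) = Dom (Mr G) fs \<and>
        Cod (Mr G) (Cmp (Mr G) gs fs) = Cod (Mr G) gs"
      using * Cmp_closed
      by (induction fs gs rule: list_induct2) (fastforce simp: Mr_def)+
  next
    fix fs gs hs assume *: "fs \<in> Arr (Mr G)" "gs \<in> Arr (Mr G)" "hs \<in> Arr (Mr G)"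
      "Cod (Mr G) fs = Dom (Mr G) gs" "Cod (Mr G) gs = Dom (Mr G) hs"
    then have "length fs = length gs" "length gs = length hs"
      by (auto simp: Mr_def dest: map_eq_imp_length_eq)
    then show "Cmp (Mr G) hs (Cmp (Mr G) gs fs) = Cmp (Mr G) (Cmp (Mr G) hs gs) fs"
      using *
      by (induction fs gs hs rule: list_induct3) (fastforce simp: Mr_def Cmp_assoc)+
  next
    fix fs assume *: "fs \<in> Arr (Mr G)"
    then show "Cmp (Mr G) fs (Ide (Mr G) (Dom (Mr G) fs)) = fs \<and>
        Cmp (Mr G) (Ide (Mr G) (Cod (Mr G) fs)) fs = fs"
      by (induction fs) (fastforce simp: Mr_def Cmp_Ide)+
    have "\<forall>f. \<exists>g. f \<in> Arr G \<longrightarrow> g \<in> Arr G \<and> Dom G g = Cod G f \<and> Cod G g = Dom G f \<and>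
          Cmp G g f = Ide G (Dom G f) \<and> Cmp G f g = Ide G (Cod G f)"
      using inverse by blast
    then obtain v where v: "\<And>f. f \<in> Arr G \<Longrightarrow> v f \<in> Arr G \<and> Dom G (v f) = Cod G f \<and>
          Cod G (v f) = Dom G f \<and> Cmp G (v f) f = Ide G (Dom G f) \<and> Cmp G f (v f) = Ide G (Cod G f)"
      by metis
    have "map v fs \<in> Arr (Mr G)"
      using * v by (auto simp: Mr_def)
    moreover have "Dom (Mr G) (map v fs) = Cod (Mr G) fs \<and> Cod (Mr G) (map v fs) = Dom (Mr G) fs \<and>
        Cmp (Mr G) (map v fs) fs = Ide (Mr G) (Dom (Mr G) fs) \<and>
        Cmp (Mr G) fs (map v fs) = Ide (Mr G) (Cod (Mr G) fs)"
      using * v by (induction fs) (fastforce simp: Mr_def)+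
    ultimately show "\<exists>gs \<in> Arr (Mr G). Dom (Mr G) gs = Cod (Mr G) fs \<and>
        Cod (Mr G) gs = Dom (Mr G) fs \<and> Cmp (Mr G) gs fs = Ide (Mr G) (Dom (Mr G) fs) \<and>
        Cmp (Mr G) fs gs = Ide (Mr G) (Cod (Mr G) fs)"
      by blast
  next
    fix xs assume "xs \<in> Obj (Mr G)"
    then show "Ide (Mr G) xs \<in> Arr (Mr G) \<and> Dom (Mr G) (Ide (Mr G) xs) = xs \<and>
        Cod (Mr G) (Ide (Mr G) xs) = xs"
      using Ide_closed by (auto simp: Mr_def map_idI subset_iff)
  qed (use Dom_closed Cod_closed in \<open>auto simp: Mr_def\<close>)
qed

lemma is_Mr_operad_Ass: "is_Mr_operad Ass"
proof -
  have units: "xs = ys" if "length xs = length ys" for xs ys :: "unit list"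
    using that by (simp add: list_eq_iff_nth_eq)
  have one: "groupoid one_grpd"
    by unfold_locales (auto simp: one_grpd_def)
  have unit_fn: "f = id" for f :: "unit \<Rightarrow> unit"
    by (rule ext) simp
  have src: "is_functor (Mr one_grpd) (Mr one_grpd) \<lparr>on_obj = id, on_arr = id\<rparr>"
    by (simp add: is_functor_def Mr_def one_grpd_def)
  have tgt: "is_functor (Mr one_grpd) one_grpd \<lparr>on_obj = (\<lambda>_. ()), on_arr = (\<lambda>_. ())\<rparr>"
    by (simp add: is_functor_def Mr_def one_grpd_def)
  have unt: "is_functor one_grpd (Mr one_grpd) (unt Ass)"
    by (simp add: is_functor_def Mr_def one_grpd_def Ass_def Mr_unit_def)
  have cmp: "is_functor (pullback_grpd (Mr (opers Ass)) (Mr_map (tgt Ass)) (src Ass) (opers Ass))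
      (opers Ass) (cmpn Ass)"
    unfolding is_functor_def
  proof (intro conjI ballI impI)
    fix f g
    assume "f \<in> Arr (pullback_grpd (Mr (opers Ass)) (Mr_map (tgt Ass)) (src Ass) (opers Ass))"
      "g \<in> Arr (pullback_grpd (Mr (opers Ass)) (Mr_map (tgt Ass)) (src Ass) (opers Ass))"
      and *: "Cod (pullback_grpd (Mr (opers Ass)) (Mr_map (tgt Ass)) (src Ass) (opers Ass)) f =
        Dom (pullback_grpd (Mr (opers Ass)) (Mr_map (tgt Ass)) (src Ass) (opers Ass)) g"
    then have "fst f = fst g"
      by (auto simp: pullback_grpd_def prod_grpd_def Mr_def Ass_def one_grpd_def prod_eq_iff)
    moreover have "map2 (map2 (\<lambda>_ _. ())) xss xss = xss" for xss :: "unit list list"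
      by (induction xss) (auto intro: units)
    ultimately show "on_arr (cmpn Ass) (Cmp (pullback_grpd (Mr (opers Ass)) (Mr_map (tgt Ass)) (src Ass) (opers Ass)) g f) =
        Cmp (opers Ass) (on_arr (cmpn Ass) g) (on_arr (cmpn Ass) f)"
      by (cases f; cases g) (auto intro!: units
        simp: pullback_grpd_def prod_grpd_def Mr_def Ass_def one_grpd_def Mr_mult_def)
  qed (auto simp: pullback_grpd_def prod_grpd_def Mr_def Ass_def one_grpd_def
        Mr_map_def Mr_mult_def subset_iff map_concat neq_Nil_conv unit_fn)
  have laws: "operad_laws {()} {xs. xs \<noteq> []} id (\<lambda>_. ()) (\<lambda>(xs, _). concat xs) (\<lambda>c. [c])"
    unfolding operad_laws_def
  proof (intro conjI allI ballI impI)
    fix yss :: "unit list list list" and xs r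
    assume "(\<forall>ys \<in> set yss. set ys \<subseteq> {xs. xs \<noteq> []}) \<and> set xs \<subseteq> {xs. xs \<noteq> []} \<and>
      r \<in> {xs. xs \<noteq> []} \<and> map (map (\<lambda>_. ())) yss = map id xs \<and> map (\<lambda>_. ()) xs = id r"
    then have "length yss = length xs"
      by (auto dest: map_eq_imp_length_eq)
    then show "(case (concat yss, case (xs, r) of (xs, _) \<Rightarrow> concat xs) of (xs, _) \<Rightarrow> concat xs) =
        (case (map (\<lambda>(xs, _). concat xs) (zip yss xs), r) of (xs, _) \<Rightarrow> concat xs)"
      by simp (induction yss xs rule: list_induct2, auto)
  qed (auto intro!: units)
  have "Obj one_grpd = {()}" "Arr one_grpd = {()}"
       "Obj (Mr one_grpd) = {xs. xs \<noteq> []}" "Arr (Mr one_grpd) = {xs. xs \<noteq> []}"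
    by (auto simp: one_grpd_def Mr_def)
  with one groupoid_Mr[OF one] src tgt unt cmp laws show ?thesis
    by (simp add: is_Mr_operad_def) (simp add: Ass_def Mr_unit_def Mr_mult_def)
qed


section \<open>The bar construction\<close>

record ('o, 'a) sgrpd =
  spl :: "nat \<Rightarrow> ('o, 'a) grpd"
  face :: "nat \<Rightarrow> nat \<Rightarrow> ('o, 'a, 'o, 'a) fnctor"   \<comment> \<open>\<open>face X n i\<close> is \<open>d\<^sub>i\<close> out of degree \<open>n\<close>\<close>
  degen :: "nat \<Rightarrow> nat \<Rightarrow> ('o, 'a, 'o, 'a) fnctor"  \<comment> \<open>\<open>degen X n i\<close> is \<open>s\<^sub>i\<close> out of degree \<open>n\<close>\<close>

text \<open>One type accommodates the level trees of all heights: colours (height 0), operations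
  (height 1), and a tuple of trees of height \<open>n - 1\<close> over a root operation (height \<open>n \<ge> 2\<close>).
  It is used both for the objects and for the arrows of the groupoids of trees.\<close>
datatype ('c, 'o) tree =
    Colour (the_colour: 'c)
  | Oper (the_oper: 'o)
  | Node (the_node: "('c, 'o) tree list \<times> 'o")

fun tree_out :: "('o \<Rightarrow> 'c) \<Rightarrow> ('c, 'o) tree \<Rightarrow> 'c" where
  "tree_out t (Colour c) = c"
| "tree_out t (Oper r) = t r"
| "tree_out t (Node (xs, r)) = t r"

definition tree_out_functor :: "('c, 'd, 'o, 'a) Mr_operad \<Rightarrow>
    (('c, 'o) tree, ('d, 'a) tree, 'c, 'd) fnctor" where
  "tree_out_functor Q =
     \<lparr>on_obj = tree_out (on_obj (tgt Q)), on_arr = tree_out (on_arr (tgt Q))\<rparr>"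

fun trees :: "('c, 'd, 'o, 'a) Mr_operad \<Rightarrow> nat \<Rightarrow> (('c, 'o) tree, ('d, 'a) tree) grpd" where
  "trees Q 0 = relabel Colour the_colour Colour the_colour (colours Q)"
| "trees Q (Suc 0) = relabel Oper the_oper Oper the_oper (opers Q)"
| "trees Q (Suc (Suc n)) = relabel Node the_node Node the_node
     (pullback_grpd (Mr (trees Q (Suc n))) (Mr_map (tree_out_functor Q)) (src Q) (opers Q))"

text \<open>The face \<open>d\<^sub>i\<close> with \<open>i < n\<close> acts on each tree of height \<open>n\<close> separately. The levels are numbered
  from the leaves to the root, so that \<open>d\<^sub>0\<close> removes the leafward level and \<open>d\<^sub>n\<^sub>-\<^sub>1\<close> composes the
  root level with the one above it.\<close>
fun tree_face :: "('o \<Rightarrow> 'c) \<Rightarrow> ('o list \<times> 'o \<Rightarrow> 'o) \<Rightarrow> nat \<Rightarrow> nat \<Rightarrow>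
    ('c, 'o) tree \<Rightarrow> ('c, 'o) tree" where
  "tree_face t m (Suc 0) i (Oper r) = Colour (t r)"
| "tree_face t m (Suc (Suc 0)) i (Node (xs, r)) =
     Oper (if i = 0 then r else m (map the_oper xs, r))"
| "tree_face t m (Suc (Suc (Suc n))) i (Node (xs, r)) =
     Node (if i = Suc (Suc n)
           then (concat (map (\<lambda>x. fst (the_node x)) xs), m (map (\<lambda>x. snd (the_node x)) xs, r))
           else (map (tree_face t m (Suc (Suc n)) i) xs, r))"

definition seq_face :: "('o \<Rightarrow> 'c list) \<Rightarrow> ('o \<Rightarrow> 'c) \<Rightarrow> ('o list \<times> 'o \<Rightarrow> 'o) \<Rightarrow> nat \<Rightarrow> nat \<Rightarrow>
    ('c, 'o) tree list \<Rightarrow> ('c, 'o) tree list" where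
  "seq_face s t m n i xs =
     (if i < n then map (tree_face t m n i) xs
      else if n = 1 then concat (map (\<lambda>x. map Colour (s (the_oper x))) xs)
      else concat (map (\<lambda>x. fst (the_node x)) xs))"

fun tree_degen :: "('o \<Rightarrow> 'c list) \<Rightarrow> ('o \<Rightarrow> 'c) \<Rightarrow> ('c \<Rightarrow> 'o) \<Rightarrow> nat \<Rightarrow> nat \<Rightarrow>
    ('c, 'o) tree \<Rightarrow> ('c, 'o) tree" where
  "tree_degen s t u 0 i (Colour c) = Oper (u c)"
| "tree_degen s t u (Suc 0) i (Oper r) =
     Node (if i = 0 then (map (\<lambda>c. Oper (u c)) (s r), r) else ([Oper r], u (t r)))"
| "tree_degen s t u (Suc (Suc n)) i (Node (xs, r)) =
     Node (if i = Suc (Suc n) then ([Node (xs, r)], u (t r))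
           else (map (tree_degen s t u (Suc n) i) xs, r))"

definition bar :: "('c, 'd, 'o, 'a) Mr_operad \<Rightarrow>
    (('c, 'o) tree list, ('d, 'a) tree list) sgrpd" where
  "bar Q =
     \<lparr>spl = (\<lambda>n. Mr (trees Q n)),
      face = (\<lambda>n i.
        \<lparr>on_obj = seq_face (on_obj (src Q)) (on_obj (tgt Q)) (on_obj (cmpn Q)) n i,
         on_arr = seq_face (on_arr (src Q)) (on_arr (tgt Q)) (on_arr (cmpn Q)) n i\<rparr>),
      degen = (\<lambda>n i.
        \<lparr>on_obj = map (tree_degen (on_obj (src Q)) (on_obj (tgt Q)) (on_obj (unt Q)) n i),
         on_arr = map (tree_degen (on_arr (src Q)) (on_arr (tgt Q)) (on_arr (unt Q)) n i)\<rparr>)\<rparr>"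


section \<open>Homotopy cardinality and homotopy fibres\<close>

definition iso_class :: "('o, 'a) grpd \<Rightarrow> 'o \<Rightarrow> 'o set" where
  "iso_class G x = {y \<in> Obj G. \<exists>f \<in> Arr G. Dom G f = x \<and> Cod G f = y}"

definition pi0 :: "('o, 'a) grpd \<Rightarrow> 'o set set" where
  "pi0 G = iso_class G ` Obj G"

definition rep :: "'o set \<Rightarrow> 'o" where
  "rep c = (SOME x. x \<in> c)"

definition Aut :: "('o, 'a) grpd \<Rightarrow> 'o \<Rightarrow> 'a set" where
  "Aut G x = {f \<in> Arr G. Dom G f = x \<and> Cod G f = x}"

text \<open>Meaningful for groupoids with finitely many components and finite automorphism groups.\<close>
definition hcard :: "('o, 'a) grpd \<Rightarrow> rat" where
  "hcard G = (\<Sum>c \<in> pi0 G. 1 / of_nat (card (Aut G (rep c))))"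

text \<open>Objects of the homotopy fibre are pairs \<open>(x, h)\<close> with \<open>h : F x \<rightarrow> b\<close>. An arrow is stored as
  \<open>(p, g, q)\<close>, with its domain \<open>p\<close> and codomain \<open>q\<close>.\<close>
definition hfib :: "('o, 'a) grpd \<Rightarrow> ('p, 'b) grpd \<Rightarrow> ('o, 'a, 'p, 'b) fnctor \<Rightarrow> 'p \<Rightarrow>
    ('o \<times> 'b, ('o \<times> 'b) \<times> 'a \<times> ('o \<times> 'b)) grpd" where
  "hfib G H F b =
     (let E = {(x, h). x \<in> Obj G \<and> h \<in> Arr H \<and> Dom H h = on_obj F x \<and> Cod H h = b} in
      \<lparr>Obj = E,
       Arr = {(p, g, q). p \<in> E \<and> q \<in> E \<and> g \<in> Arr G \<and> Dom G g = fst p \<and> Cod G g = fst q \<and>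
                Cmp H (snd q) (on_arr F g) = snd p},
       Dom = (\<lambda>(p, g, q). p),
       Cod = (\<lambda>(p, g, q). q),
       Ide = (\<lambda>p. (p, Ide G (fst p), p)),
       Cmp = (\<lambda>(_, g', r) (p, g, _). (p, Cmp G g' g, r))\<rparr>)"


section \<open>Bialgebras over the rationals on a given basis\<close>

text \<open>A rational vector space with basis \<open>B\<close> is the set of finitely supported functions
  \<open>'b \<Rightarrow>\<^sub>0 rat\<close> with support in \<open>B\<close>; its tensor square has basis \<open>B \<times> B\<close>.\<close>

definition span_on :: "'b set \<Rightarrow> ('b \<Rightarrow>\<^sub>0 rat) set" where
  "span_on B = {p. Poly_Mapping.keys p \<subseteq> B}"

definition delta :: "'b \<Rightarrow> 'b \<Rightarrow>\<^sub>0 rat" where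
  "delta x = Poly_Mapping.single x 1"

definition scale :: "rat \<Rightarrow> ('b \<Rightarrow>\<^sub>0 rat) \<Rightarrow> ('b \<Rightarrow>\<^sub>0 rat)" where
  "scale c p = Poly_Mapping.map ((*) c) p"

definition lin :: "('b \<Rightarrow> ('c \<Rightarrow>\<^sub>0 rat)) \<Rightarrow> ('b \<Rightarrow>\<^sub>0 rat) \<Rightarrow> ('c \<Rightarrow>\<^sub>0 rat)" where
  "lin f p = (\<Sum>x \<in> Poly_Mapping.keys p. scale (Poly_Mapping.lookup p x) (f x))"

definition lin_form :: "('b \<Rightarrow> rat) \<Rightarrow> ('b \<Rightarrow>\<^sub>0 rat) \<Rightarrow> rat" where
  "lin_form e p = (\<Sum>x \<in> Poly_Mapping.keys p. Poly_Mapping.lookup p x * e x)"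

definition tensor :: "('b \<Rightarrow>\<^sub>0 rat) \<Rightarrow> ('c \<Rightarrow>\<^sub>0 rat) \<Rightarrow> ('b \<times> 'c \<Rightarrow>\<^sub>0 rat)" where
  "tensor p q = lin (\<lambda>x. lin (\<lambda>y. delta (x, y)) q) p"

text \<open>The structure maps are given by their values on basis vectors and extended linearly.\<close>
record 'b bialg =
  basis :: "'b set"
  bmul :: "'b \<Rightarrow> 'b \<Rightarrow> ('b \<Rightarrow>\<^sub>0 rat)"
  bone :: "'b \<Rightarrow>\<^sub>0 rat"
  bcomul :: "'b \<Rightarrow> ('b \<times> 'b \<Rightarrow>\<^sub>0 rat)"
  bcounit :: "'b \<Rightarrow> rat"

definition mul :: "'b bialg \<Rightarrow> ('b \<Rightarrow>\<^sub>0 rat) \<Rightarrow> ('b \<Rightarrow>\<^sub>0 rat) \<Rightarrow> ('b \<Rightarrow>\<^sub>0 rat)" where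
  "mul A p q = lin (\<lambda>(x, y). bmul A x y) (tensor p q)"

definition mul2 :: "'b bialg \<Rightarrow> ('b \<times> 'b \<Rightarrow>\<^sub>0 rat) \<Rightarrow> ('b \<times> 'b \<Rightarrow>\<^sub>0 rat) \<Rightarrow>
    ('b \<times> 'b \<Rightarrow>\<^sub>0 rat)" where
  "mul2 A p q = lin (\<lambda>((x, y), (x', y')). tensor (bmul A x x') (bmul A y y')) (tensor p q)"

locale bialgebra =
  fixes A :: "'b bialg"
  assumes bmul_closed: "\<lbrakk>x \<in> basis A; y \<in> basis A\<rbrakk> \<Longrightarrow> bmul A x y \<in> span_on (basis A)"
    and bone_closed: "bone A \<in> span_on (basis A)"
    and bcomul_closed: "x \<in> basis A \<Longrightarrow> bcomul A x \<in> span_on (basis A \<times> basis A)"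
    and assoc: "\<lbrakk>x \<in> basis A; y \<in> basis A; z \<in> basis A\<rbrakk> \<Longrightarrow>
          mul A (bmul A x y) (delta z) = mul A (delta x) (bmul A y z)"
    and left_one: "x \<in> basis A \<Longrightarrow> mul A (bone A) (delta x) = delta x"
    and right_one: "x \<in> basis A \<Longrightarrow> mul A (delta x) (bone A) = delta x"
    and coassoc: "x \<in> basis A \<Longrightarrow>
          lin (\<lambda>(y, z). lin (\<lambda>(y', y''). delta (y', y'', z)) (bcomul A y)) (bcomul A x) =
          lin (\<lambda>(y, z). lin (\<lambda>(z', z''). delta (y, z', z'')) (bcomul A z)) (bcomul A x)"
    and left_counit: "x \<in> basis A \<Longrightarrow>
          lin (\<lambda>(y, z). scale (bcounit A y) (delta z)) (bcomul A x) = delta x"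
    and right_counit: "x \<in> basis A \<Longrightarrow>
          lin (\<lambda>(y, z). scale (bcounit A z) (delta y)) (bcomul A x) = delta x"
    and bcomul_bmul: "\<lbrakk>x \<in> basis A; y \<in> basis A\<rbrakk> \<Longrightarrow>
          lin (bcomul A) (bmul A x y) = mul2 A (bcomul A x) (bcomul A y)"
    and bcomul_bone: "lin (bcomul A) (bone A) = tensor (bone A) (bone A)"
    and bcounit_bmul: "\<lbrakk>x \<in> basis A; y \<in> basis A\<rbrakk> \<Longrightarrow>
          lin_form (bcounit A) (bmul A x y) = bcounit A x * bcounit A y"
    and bcounit_bone: "lin_form (bcounit A) (bone A) = 1"

text \<open>\<open>f\<close> lists the values on the basis of the linear map \<open>lin f\<close>.\<close>
definition bialgebra_iso :: "('b \<Rightarrow> ('c \<Rightarrow>\<^sub>0 rat)) \<Rightarrow> 'b bialg \<Rightarrow> 'c bialg \<Rightarrow> bool" where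
  "bialgebra_iso f A B \<longleftrightarrow>
     bij_betw (lin f) (span_on (basis A)) (span_on (basis B)) \<and>
     lin f (bone A) = bone B \<and>
     (\<forall>x \<in> basis A. \<forall>y \<in> basis A. lin f (bmul A x y) = mul B (f x) (f y)) \<and>
     (\<forall>x \<in> basis A. lin (\<lambda>(y, z). tensor (f y) (f z)) (bcomul A x) = lin (bcomul B) (f x)) \<and>
     (\<forall>x \<in> basis A. bcounit A x = lin_form (bcounit B) (f x))"

definition bialgebra_isomorphic :: "'b bialg \<Rightarrow> 'c bialg \<Rightarrow> bool" where
  "bialgebra_isomorphic A B \<longleftrightarrow> bialgebra A \<and> bialgebra B \<and> (\<exists>f. bialgebra_iso f A B)"


section \<open>The incidence bialgebra\<close>

definition fib_d1 :: "('o, 'a) sgrpd \<Rightarrow> 'o \<Rightarrow> ('o \<times> 'a, ('o \<times> 'a) \<times> 'a \<times> ('o \<times> 'a)) grpd" where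
  "fib_d1 X f = hfib (spl X 2) (spl X 1) (face X 2 1) f"

definition d2_d0 :: "('o, 'a) sgrpd \<Rightarrow>
    ('o \<times> 'a, ('o \<times> 'a) \<times> 'a \<times> ('o \<times> 'a), 'o \<times> 'o, 'a \<times> 'a) fnctor" where
  "d2_d0 X =
     \<lparr>on_obj = (\<lambda>(x, h). (on_obj (face X 2 2) x, on_obj (face X 2 0) x)),
      on_arr = (\<lambda>(p, g, q). (on_arr (face X 2 2) g, on_arr (face X 2 0) g))\<rparr>"

definition Phi :: "('o, 'a) sgrpd \<Rightarrow> 'o \<Rightarrow> 'o \<Rightarrow> 'o \<Rightarrow> _" where
  "Phi X f a b = hfib (fib_d1 X f) (prod_grpd (spl X 1) (spl X 1)) (d2_d0 X) (a, b)"

definition incidence_coeff :: "('o, 'a) sgrpd \<Rightarrow> 'o \<Rightarrow> 'o \<Rightarrow> 'o \<Rightarrow> rat" where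
  "incidence_coeff X f a b =
     hcard (Phi X f a b) / (of_nat (card (Aut (spl X 1) a)) * of_nat (card (Aut (spl X 1) b)))"

text \<open>The sum is restricted to nonzero coefficients, which must be finite in number.\<close>
definition incidence_comul :: "('o, 'a) sgrpd \<Rightarrow> 'o set \<Rightarrow> ('o set \<times> 'o set \<Rightarrow>\<^sub>0 rat)" where
  "incidence_comul X f =
     (\<Sum>(a, b) | a \<in> pi0 (spl X 1) \<and> b \<in> pi0 (spl X 1) \<and> incidence_coeff X (rep f) (rep a) (rep b) \<noteq> 0.
        scale (incidence_coeff X (rep f) (rep a) (rep b)) (delta (a, b)))"

definition incidence_counit :: "('o, 'a) sgrpd \<Rightarrow> 'o set \<Rightarrow> rat" where
  "incidence_counit X f = hcard (hfib (spl X 0) (spl X 1) (degen X 0 0) (rep f))"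

text \<open>The simplices of \<open>X\<close> are tuples, multiplied by concatenation; the tuples being nonempty, the
  basis element \<open>None\<close> is adjoined as unit.\<close>
definition incidence_bialgebra :: "('x list, 'a) sgrpd \<Rightarrow> 'x list set option bialg" where
  "incidence_bialgebra X =
     \<lparr>basis = insert None (Some ` pi0 (spl X 1)),
      bmul = (\<lambda>a b. delta (case (a, b) of
          (None, _) \<Rightarrow> b
        | (_, None) \<Rightarrow> a
        | (Some c, Some d) \<Rightarrow> Some (iso_class (spl X 1) (rep c @ rep d)))),
      bone = delta None,
      bcomul = case_option (delta (None, None))
        (\<lambda>f. lin (\<lambda>(a, b). delta (Some a, Some b)) (incidence_comul X f)),
      bcounit = case_option 1 (incidence_counit X)\<rparr>"


section \<open>The noncommutative Faa di Bruno bialgebra\<close>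

text \<open>The free monoid, so that \<open>nat list \<Rightarrow>\<^sub>0 rat\<close> with its convolution product is a free associative
  algebra, and \<open>nat list \<times> nat list \<Rightarrow>\<^sub>0 rat\<close> is its tensor square.\<close>
instantiation list :: (type) monoid_add
begin
definition zero_list :: "'a list" where "zero_list = []"
definition plus_list :: "'a list \<Rightarrow> 'a list \<Rightarrow> 'a list" where "plus_list = (@)"
instance by standard (simp_all add: zero_list_def plus_list_def)
end

text \<open>The two components of the generic pair \<open>(F, G)\<close> of power series without constant term:
  the coefficient of \<open>x\<^sup>n\<close> is \<open>a\<^sub>n \<otimes> 1\<close> in \<open>F\<close> and \<open>1 \<otimes> a\<^sub>n\<close> in \<open>G\<close>.\<close>
definition generic_F :: "(nat list \<times> nat list \<Rightarrow>\<^sub>0 rat) fps" where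
  "generic_F = Abs_fps (\<lambda>n. if n = 0 then 0 else delta ([n], []))"

definition generic_G :: "(nat list \<times> nat list \<Rightarrow>\<^sub>0 rat) fps" where
  "generic_G = Abs_fps (\<lambda>n. if n = 0 then 0 else delta ([], [n]))"

text \<open>The basis consists of the monomials in \<open>a\<^sub>1, a\<^sub>2, \<dots>\<close>, encoded as lists of positive indices.
  The comultiplication and the counit are the algebra homomorphisms which send \<open>a\<^sub>n\<close> to the
  \<open>n\<close>-th coefficient of \<open>G \<circ> F\<close> and of the series \<open>x\<close>, respectively.\<close>
definition nc_Faa_di_Bruno :: "nat list bialg" where
  "nc_Faa_di_Bruno =
     \<lparr>basis = {w. 0 \<notin> set w},
      bmul = (\<lambda>v w. delta v * delta w),
      bone = 1,
      bcomul = (\<lambda>w. prod_list (map (\<lambda>n. fps_nth (fps_compose generic_G generic_F) n) w)),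
      bcounit = (\<lambda>w. prod_list (map (\<lambda>n. fps_nth fps_X n) w))\<rparr>"

text \<open>The element \<open>u \<otimes> v\<close> of the tensor square is evaluated at a pair \<open>(F, G)\<close> of power series over
  an arbitrary ring as \<open>v(G) u(F)\<close>, the scalars acting through \<open>h\<close>. The comultiplication then satisfies
  \<open>\<Delta>(a\<^sub>n)(F, G) = a\<^sub>n(G \<circ> F)\<close>.\<close>
definition eval2 :: "(rat \<Rightarrow> 'r::ring_1) \<Rightarrow> 'r fps \<Rightarrow> 'r fps \<Rightarrow> (nat list \<times> nat list \<Rightarrow>\<^sub>0 rat) \<Rightarrow> 'r" where
  "eval2 h F G p = (\<Sum>(u, v) \<in> Poly_Mapping.keys p. h (Poly_Mapping.lookup p (u, v)) *
     (prod_list (map (fps_nth G) v) * prod_list (map (fps_nth F) u)))"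

lemma bcomul_nc_Faa_di_Bruno_substitution:
  fixes h :: "rat \<Rightarrow> 'r::ring_1" and F G :: "'r fps"
  assumes h: "\<And>a b. h (a + b) = h a + h b" "h 1 = 1"
    and F: "fps_nth F 0 = 0" and G: "fps_nth G 0 = 0"
  shows "eval2 h F G (bcomul nc_Faa_di_Bruno [n]) = fps_nth (fps_compose G F) n"
proof -
  let ?e = "eval2 h F G"
  have h0: "h 0 = 0"
    using h(1)[of 0 0] by simp
  have e_superset: "?e p = (\<Sum>(u, v) \<in> K. h (Poly_Mapping.lookup p (u, v)) *
      (prod_list (map (fps_nth G) v) * prod_list (map (fps_nth F) u)))"
    if "finite K" "Poly_Mapping.keys p \<subseteq> K" for p K
    unfolding eval2_def using that
    by (intro sum.mono_neutral_left) (auto simp: in_keys_iff h0)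
  have e_add: "?e (p + q) = ?e p + ?e q" for p q
  proof -
    let ?K = "Poly_Mapping.keys p \<union> Poly_Mapping.keys q"
    have "Poly_Mapping.keys (p + q) \<subseteq> ?K"
      by (rule Poly_Mapping.keys_add)
    then show ?thesis
      by (simp add: e_superset[of ?K] lookup_add h(1) distrib_right split_def sum.distrib)
  qed
  have e_0: "?e 0 = 0"
    by (simp add: eval2_def)
  have e_sum: "?e (sum f I) = (\<Sum>i \<in> I. ?e (f i))" for f and I :: "nat set"
    by (induction I rule: infinite_finite_induct) (simp_all add: e_0 e_add)
  have e_single: "?e (Poly_Mapping.single (u, v) c) =
      h c * (prod_list (map (fps_nth G) v) * prod_list (map (fps_nth F) u))" for u v c
    by (cases "c = 0") (simp_all add: eval2_def h0)
  have e_mult_F: "?e (p * fps_nth generic_F k) = ?e p * fps_nth F k" for p k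
  proof (induction p rule: update_induct)
    case const
    then show ?case by (simp add: e_0)
  next
    case (update f a b)
    have "Poly_Mapping.update a b f = f + Poly_Mapping.single a b"
      using update(1) by (intro poly_mapping_eqI)
        (auto simp: lookup_update lookup_add lookup_single in_keys_iff when_def)
    moreover have "?e (Poly_Mapping.single a b * fps_nth generic_F k) =
        ?e (Poly_Mapping.single a b) * fps_nth F k"
      by (cases a) (simp add: generic_F_def F e_0 delta_def mult_single plus_list_def zero_list_def
          e_single mult.assoc)
    ultimately show ?case
      using update(3) by (simp add: distrib_right e_add)
  qed
  have e_mult_pow: "?e (p * fps_nth (generic_F ^ k) m) = ?e p * fps_nth (F ^ k) m" for p k m
  proof (induction k arbitrary: p m)
    case 0
    then show ?case by (simp add: e_0)
  next
    case (Suc k)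
    then show ?case
      by (simp add: fps_mult_nth sum_distrib_left e_sum mult.assoc[symmetric] e_mult_F)
  qed
  have e_G: "?e (fps_nth generic_G k) = fps_nth G k" for k
    by (simp add: generic_G_def delta_def e_single e_0 G h(2))
  show ?thesis
    by (simp add: nc_Faa_di_Bruno_def fps_compose_nth e_sum e_mult_pow e_G)
qed

end

theory Submission
  imports Defs
begin

text \<open>
  For \<open>Ass\<close> all groupoids in the bar construction are discrete, so homotopy cardinalities just count
  elements. A 1-simplex is a word of positive integers (the arities), and a 2-simplex is a word
  \<open>t\<close> of such words, with \<open>d\<^sub>2 t\<close> the concatenation of \<open>t\<close>, \<open>d\<^sub>0 t\<close> the word of lengths and
  \<open>d\<^sub>1 t\<close> the word of sums. Hence \<open>\<Delta> w\<close> is the sum of \<open>d\<^sub>2 t \<otimes> d\<^sub>0 t\<close> over all \<open>t\<close> with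
  \<open>d\<^sub>1 t = w\<close>. On the other side, the coefficient of \<open>x\<^sup>n\<close> in \<open>G \<circ> F\<close> expands as the sum over
  compositions \<open>(n\<^sub>1, \<dots>, n\<^sub>k)\<close> of \<open>n\<close> of \<open>a(n\<^sub>1) \<cdots> a(n\<^sub>k) \<otimes> a(k)\<close>, which is the same formula for
  one-letter words, and both comultiplications are multiplicative.
\<close>

section \<open>Linear extension\<close>

lemma lookup_scale: "Poly_Mapping.lookup (scale c p) x = c * Poly_Mapping.lookup p x"
  by (simp add: scale_def map.rep_eq when_def)

lemma scale_0 [simp]: "scale 0 p = 0"
  by (intro poly_mapping_eqI) (simp add: lookup_scale)

lemma scale_1 [simp]: "scale 1 p = p"
  by (intro poly_mapping_eqI) (simp add: lookup_scale)

lemma scale_zero_right [simp]: "scale c 0 = 0"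
  by (intro poly_mapping_eqI) (simp add: lookup_scale)

lemma scale_add_left: "scale (c + d) p = scale c p + scale d p"
  by (intro poly_mapping_eqI) (simp add: lookup_scale lookup_add distrib_right)

lemma scale_add_right: "scale c (p + q) = scale c p + scale c q"
  by (intro poly_mapping_eqI) (simp add: lookup_scale lookup_add distrib_left)

lemma scale_scale [simp]: "scale c (scale d p) = scale (c * d) p"
  by (intro poly_mapping_eqI) (simp add: lookup_scale mult.assoc)

lemma scale_sum: "scale c (sum f I) = (\<Sum>i\<in>I. scale c (f i))"
  by (induction I rule: infinite_finite_induct) (simp_all add: scale_add_right)

text \<open>Keys outside the support contribute terms scaled by zero. Enlarging the index set lets
  vectors with different supports be compared over one common finite set, which is how additivity is
  obtained.\<close>

lemma lin_superset:
  assumes "finite K" "Poly_Mapping.keys p \<subseteq> K"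
  shows "lin f p = (\<Sum>x\<in>K. scale (Poly_Mapping.lookup p x) (f x))"
  unfolding lin_def using assms by (intro sum.mono_neutral_left) (auto simp: in_keys_iff)

lemma lin_zero [simp]: "lin f 0 = 0"
  by (simp add: lin_def)

lemma lin_add: "lin f (p + q) = lin f p + lin f q"
proof -
  let ?K = "Poly_Mapping.keys p \<union> Poly_Mapping.keys q"
  have "Poly_Mapping.keys (p + q) \<subseteq> ?K"
    by (rule Poly_Mapping.keys_add)
  then show ?thesis
    by (simp add: lin_superset[of ?K] lookup_add scale_add_left sum.distrib)
qed

lemma lin_sum: "lin f (sum g I) = (\<Sum>i\<in>I. lin f (g i))"
  by (induction I rule: infinite_finite_induct) (simp_all add: lin_add)

lemma keys_scale: "Poly_Mapping.keys (scale c p) \<subseteq> Poly_Mapping.keys p"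
  by (auto simp: in_keys_iff lookup_scale)

lemma lin_scale: "lin f (scale c p) = scale c (lin f p)"
  using lin_superset[OF finite_keys keys_scale, of f c p]
  by (simp add: lin_def[of f p] lookup_scale scale_sum)

lemma lin_delta [simp]: "lin f (delta x) = f x"
  by (simp add: lin_def delta_def)

lemma lin_lin: "lin f (lin g p) = lin (\<lambda>x. lin f (g x)) p"
  by (simp add: lin_def[of g] lin_sum lin_scale) (simp add: lin_def)

lemma lin_cong: "(\<And>x. x \<in> Poly_Mapping.keys p \<Longrightarrow> f x = g x) \<Longrightarrow> lin f p = lin g p"
  by (simp add: lin_def)

lemma lin_delta_id: "lin delta p = p"
proof (intro poly_mapping_eqI)
  fix k
  have "Poly_Mapping.lookup (lin delta p) k =
      (\<Sum>x\<in>Poly_Mapping.keys p. if x = k then Poly_Mapping.lookup p x else 0)"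
    unfolding lin_def lookup_sum
    by (intro sum.cong) (auto simp: lookup_scale delta_def lookup_single when_def)
  then show "Poly_Mapping.lookup (lin delta p) k = Poly_Mapping.lookup p k"
    by (simp add: in_keys_iff)
qed

lemma lin_form_delta [simp]: "lin_form e (delta x) = e x"
  by (simp add: lin_form_def delta_def)

lemma tensor_delta [simp]: "tensor (delta x) (delta y) = delta (x, y)"
  by (simp add: tensor_def)

lemma tensor_sum:
  "tensor (\<Sum>i\<in>I. delta (f i)) (\<Sum>j\<in>J. delta (g j)) = (\<Sum>i\<in>I. \<Sum>j\<in>J. delta (f i, g j))"
  by (simp add: tensor_def lin_sum)

section \<open>Subspaces spanned by sets of basis elements\<close>

lemma delta_in_span_on [simp]: "delta x \<in> span_on B \<longleftrightarrow> x \<in> B"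
  by (simp add: span_on_def delta_def)

lemma sum_in_span_on: "(\<And>i. i \<in> I \<Longrightarrow> f i \<in> span_on B) \<Longrightarrow> sum f I \<in> span_on B"
  using keys_sum[of f I] by (fastforce simp: span_on_def)

lemma lin_in_span_on:
  assumes "\<And>x. x \<in> B \<Longrightarrow> f x \<in> span_on C" "p \<in> span_on B"
  shows "lin f p \<in> span_on C"
  unfolding lin_def using assms keys_scale
  by (intro sum_in_span_on) (fastforce simp: span_on_def)

text \<open>The inverse is the linear extension of \<open>inv_into B g\<close>. This undoes
  \<open>g\<close> only on \<open>B\<close> and \<open>C\<close>, so the cancellation is applied on
  the keys of a vector of the span, and \<open>lin_delta_id\<close> finishes.\<close>

lemma bij_betw_lin_delta:
  assumes "bij_betw g B C"
  shows "bij_betw (lin (\<lambda>x. delta (g x))) (span_on B) (span_on C)"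
proof (rule bij_betw_byWitness[where f' = "lin (\<lambda>y. delta (inv_into B g y))"])
  have inv: "inv_into B g (g x) = x" if "x \<in> B" for x
    using assms that by (simp add: bij_betw_def)
  have inv': "g (inv_into B g y) = y" "inv_into B g y \<in> B" if "y \<in> C" for y
    using assms that by (auto simp: bij_betw_def f_inv_into_f inv_into_into)
  show "\<forall>p\<in>span_on B. lin (\<lambda>y. delta (inv_into B g y)) (lin (\<lambda>x. delta (g x)) p) = p"
    using inv by (auto simp: lin_lin span_on_def subset_iff intro!: trans[OF lin_cong lin_delta_id])
  show "\<forall>p\<in>span_on C. lin (\<lambda>x. delta (g x)) (lin (\<lambda>y. delta (inv_into B g y)) p) = p"
    using inv' by (auto simp: lin_lin span_on_def subset_iff intro!: trans[OF lin_cong lin_delta_id])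
  show "lin (\<lambda>x. delta (g x)) ` span_on B \<subseteq> span_on C"
    using assms by (auto intro!: lin_in_span_on[where B = B] simp: bij_betw_def)
  show "lin (\<lambda>y. delta (inv_into B g y)) ` span_on C \<subseteq> span_on B"
    using inv' by (auto intro!: lin_in_span_on[where B = C])
qed


section \<open>Compositions of words\<close>

text \<open>Compositions of \<open>n\<close> in the combinatorial sense: a list \<open>ns\<close>
  stands for the two-level tree whose branches have the arities \<open>ns\<close>, and its sum is
  the number of leaves. The number 0 has no composition.\<close>

definition comps :: "nat \<Rightarrow> nat list set" where
  "comps n = {ns. ns \<noteq> [] \<and> 0 \<notin> set ns \<and> sum_list ns = n}"

text \<open>For nonempty positive \<open>w\<close> this is the fibre of \<open>d_1\<close> over the
  1-simplex \<open>w\<close>. The empty word has exactly the empty forest, which corresponds to the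
  adjoined unit.\<close>

definition word_comps :: "nat list \<Rightarrow> nat list list set" where
  "word_comps w = {t. (\<forall>ns\<in>set t. ns \<noteq> [] \<and> 0 \<notin> set ns) \<and> map sum_list t = w}"

lemma length_le_sum_list: "0 \<notin> set ns \<Longrightarrow> length ns \<le> sum_list (ns :: nat list)"
  by (induction ns) auto

lemma finite_positive_lists: "finite {ns. 0 \<notin> set ns \<and> sum_list ns = (n::nat)}"
proof (rule finite_subset)
  show "{ns. 0 \<notin> set ns \<and> sum_list ns = n} \<subseteq> {ns. set ns \<subseteq> {..n} \<and> length ns \<le> n}"
    using length_le_sum_list member_le_sum_list by fastforce
qed (simp add: finite_lists_length_le)

lemma finite_comps [simp]: "finite (comps n)"
  by (rule finite_subset[OF _ finite_positive_lists[of n]]) (auto simp: comps_def)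

lemma word_comps_Nil [simp]: "word_comps [] = {[]}"
  by (auto simp: word_comps_def)

lemma word_comps_Cons: "word_comps (n # w) = (\<lambda>(ns, t). ns # t) ` (comps n \<times> word_comps w)"
  by (auto simp: word_comps_def comps_def image_iff map_eq_Cons_conv)

lemma finite_word_comps [simp]: "finite (word_comps w)"
  by (induction w) (simp_all add: word_comps_Cons)

lemma sum_word_comps_Cons:
  "(\<Sum>t\<in>word_comps (n # w). f t) = (\<Sum>ns\<in>comps n. \<Sum>t\<in>word_comps w. f (ns # t))"
  by (simp add: word_comps_Cons sum.reindex inj_on_def sum.cartesian_product split_def)

text \<open>A forest over a concatenated word is cut uniquely into forests over the two parts. This
  is the source of the multiplicativity of the comultiplication.\<close>

lemma sum_word_comps_append:
  "(\<Sum>t\<in>word_comps (v @ w). f t) = (\<Sum>s\<in>word_comps v. \<Sum>t\<in>word_comps w. f (s @ t))"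
  by (induction v arbitrary: f) (simp_all add: sum_word_comps_Cons)

lemma word_comps_positive:
  assumes "t \<in> word_comps w"
  shows "0 \<notin> set (concat t)" "0 \<notin> set (map length t)"
  using assms by (auto simp: word_comps_def)

section \<open>Forests with one trivial level, for the counit laws\<close>

lemma sum_list_replicate_1:
  "set ns \<subseteq> {Suc 0} \<Longrightarrow> ns = replicate (sum_list ns) (Suc 0)"
  by (induction ns) auto

text \<open>Left counit law in combinatorial form: the counit keeps the forests whose leafward
  operations are all unary, and a list of ones is determined by its sum. Positivity of the letters
  keeps the resulting trees nonempty.\<close>

lemma word_comps_leaves_trivial:
  assumes "0 \<notin> set w"
  shows "{t \<in> word_comps w. set (concat t) \<subseteq> {1}} = {map (\<lambda>n. replicate n 1) w}"
proof (intro subset_antisym subsetI)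
  fix t assume t: "t \<in> {t \<in> word_comps w. set (concat t) \<subseteq> {1}}"
  then have w: "w = map sum_list t"
    by (simp add: word_comps_def)
  have "ns = replicate (sum_list ns) 1" if "ns \<in> set t" for ns
    using sum_list_replicate_1[of ns] t that by fastforce
  then have "t = map (\<lambda>n. replicate n 1) (map sum_list t)"
    by (simp add: list_eq_iff_nth_eq)
  then show "t \<in> {map (\<lambda>n. replicate n 1) w}"
    unfolding w by (rule singleton_iff[THEN iffD2])
next
  show "t \<in> {t \<in> word_comps w. set (concat t) \<subseteq> {1}}" if "t \<in> {map (\<lambda>n. replicate n 1) w}" for t
    using assms that by (auto simp: word_comps_def sum_list_replicate o_def map_idI intro: gr0I)
qed

text \<open>Right counit law in combinatorial form: with unary roots, each tree is a single branch
  carrying all the leaves.\<close>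

lemma word_comps_roots_trivial:
  assumes "0 \<notin> set w"
  shows "{t \<in> word_comps w. set (map length t) \<subseteq> {1}} = {map (\<lambda>n. [n]) w}"
proof (intro subset_antisym subsetI)
  fix t assume t: "t \<in> {t \<in> word_comps w. set (map length t) \<subseteq> {1}}"
  then have w: "w = map sum_list t"
    by (simp add: word_comps_def)
  have "ns = [sum_list ns]" if "ns \<in> set t" for ns
  proof -
    have "length ns = Suc 0"
      using t that by auto
    then show ?thesis
      by (auto simp: length_Suc_conv)
  qed
  then have "t = map (\<lambda>n. [n]) (map sum_list t)"
    by (simp add: list_eq_iff_nth_eq)
  then show "t \<in> {map (\<lambda>n. [n]) w}"
    unfolding w by (rule singleton_iff[THEN iffD2])
next
  show "t \<in> {t \<in> word_comps w. set (map length t) \<subseteq> {1}}" if "t \<in> {map (\<lambda>n. [n]) w}" for t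
    using assms that by (auto simp: word_comps_def o_def intro: gr0I)
qed

text \<open>Three-level trees; both sides of the coassociativity law are indexed by them.\<close>
definition word_comps2 :: "nat list \<Rightarrow> nat list list list set" where
  "word_comps2 w = {z. (\<forall>m\<in>set z. m \<noteq> [] \<and> (\<forall>ns\<in>set m. ns \<noteq> [] \<and> 0 \<notin> set ns)) \<and>
     map (\<lambda>m. sum_list (concat m)) z = w}"

text \<open>Since \<open>map\<close> preserves positions, a cutting of the image list can be carried
  out on the original list. It serves to rebuild a three-level forest from its two leafward levels
  and the grouping prescribed by the roots.\<close>

lemma split_along_map:
  assumes "map f ys = concat xss"
  obtains zss where "concat zss = ys" "map (map f) zss = xss"
proof -
  have "\<exists>zss. concat zss = ys \<and> map (map f) zss = xss"
    using assms
  proof (induction xss arbitrary: ys)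
    case (Cons xs xss)
    then obtain us vs where "ys = us @ vs" "map f us = xs" "map f vs = concat xss"
      by (auto simp: map_eq_append_conv)
    with Cons.IH[of vs] obtain zss where "concat zss = vs" "map (map f) zss = xss"
      by blast
    then have "concat (us # zss) = ys \<and> map (map f) (us # zss) = xs # xss"
      using \<open>ys = us @ vs\<close> \<open>map f us = xs\<close> by simp
    then show ?case by (rule exI)
  qed simp
  then show ?thesis using that by blast
qed

text \<open>Successive blocks are taken off the front with \<open>take\<close> and
  \<open>drop\<close>. It serves to rebuild a three-level tree from its leafward arities and its two
  rootward levels.\<close>

lemma split_into_lengths:
  assumes "sum_list ls = length xs"
  obtains xss where "concat xss = xs" "map length xss = ls"
proof -
  have "\<exists>xss. concat xss = xs \<and> map length xss = ls"
    using assms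
  proof (induction ls arbitrary: xs)
    case (Cons l ls)
    then obtain xss where "concat xss = drop l xs" "map length xss = ls"
      by (metis add_diff_cancel_left' length_drop sum_list.Cons)
    moreover have "length (take l xs) = l"
      using Cons.prems by simp
    ultimately have "concat (take l xs # xss) = xs \<and> map length (take l xs # xss) = l # ls"
      by simp
    then show ?case by (rule exI)
  qed simp
  then show ?thesis using that by blast
qed

text \<open>The block lengths record where the flattened list has to be cut.\<close>

lemma concat_map_length_inject:
  assumes "concat xss = concat yss" "map length xss = map length yss"
  shows "xss = yss"
  using assms by (induction xss yss rule: list_induct2') auto

lemma concat_concat: "concat (concat xsss) = concat (map concat xsss)"
  by (induction xsss) simp_all

lemma sum_list_concat: "sum_list (concat xss) = sum_list (map sum_list xss)"
  by (induction xss) simp_all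

lemma sum_list_positive:
  fixes ns :: "nat list"
  assumes "ns \<noteq> []" "0 \<notin> set ns"
  shows "0 < sum_list ns"
  using assms by (cases ns) auto

text \<open>The two components are the faces \<open>d_1\<close> (compose the two leafward levels)
  and \<open>d_3\<close> (remove the roots) of a 3-simplex. The bijection expresses a pullback
  square of the decomposition space condition, restricted to the fibre over
  \<open>w\<close>.\<close>

lemma bij_betw_word_comps2_lower:
  "bij_betw (\<lambda>z. (map (map sum_list) z, concat z)) (word_comps2 w)
     (SIGMA x:word_comps w. word_comps (concat x))"
  unfolding bij_betw_def
proof (intro conjI subset_antisym subsetI)
  show "inj_on (\<lambda>z. (map (map sum_list) z, concat z)) (word_comps2 w)"
  proof (rule inj_onI)
    fix z z' :: "nat list list list"
    assume *: "(map (map sum_list) z, concat z) = (map (map sum_list) z', concat z')"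
    \<comment> \<open>Composing the leafward levels keeps the number of branches at each root, so
      the first component still knows the block lengths of \<open>z\<close>.\<close>
    then have "map length (map (map sum_list) z) = map length (map (map sum_list) z')"
      by (simp only: prod.inject)
    then have "map length z = map length z'"
      by (simp add: o_def)
    with * show "z = z'"
      by (intro concat_map_length_inject) simp_all
  qed
next
  fix p assume "p \<in> (\<lambda>z. (map (map sum_list) z, concat z)) ` word_comps2 w"
  then obtain z where z: "z \<in> word_comps2 w" "p = (map (map sum_list) z, concat z)"
    by blast
  have "map sum_list (concat z) = concat (map (map sum_list) z)"
    by (simp add: map_concat)
  \<comment> \<open>The composed operations are again of positive arity, because a nonempty list of
    positive numbers has positive sum.\<close>
  moreover have "0 \<notin> set (map sum_list m)" if "m \<in> set z" for m
    using that z(1) sum_list_positive by (fastforce simp: word_comps2_def simp del: sum_list_eq_0_iff)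
  ultimately show "p \<in> (SIGMA x:word_comps w. word_comps (concat x))"
    using z by (auto simp: word_comps_def word_comps2_def sum_list_concat simp del: sum_list_eq_0_iff)
next
  fix p assume "p \<in> (SIGMA x:word_comps w. word_comps (concat x))"
  then obtain x y where p: "p = (x, y)" "x \<in> word_comps w" "y \<in> word_comps (concat x)"
    by blast
  \<comment> \<open>The blocks of \<open>x\<close> cut \<open>concat x\<close>, which is the list of
    sums of \<open>y\<close>; the cut is transported back to \<open>y\<close>.\<close>
  then obtain z where z: "concat z = y" "map (map sum_list) z = x"
    by (auto simp: word_comps_def elim: split_along_map)
  have "z \<in> word_comps2 w"
    using p(2,3) unfolding z[symmetric]
    by (auto simp: word_comps_def word_comps2_def sum_list_concat simp del: sum_list_eq_0_iff)
  with p z show "p \<in> (\<lambda>z. (map (map sum_list) z, concat z)) ` word_comps2 w"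
    by blast
qed

text \<open>The companion square, with the faces \<open>d_2\<close> (compose the two rootward
  levels) and \<open>d_0\<close> (remove the leafward level).\<close>

lemma bij_betw_word_comps2_upper:
  "bij_betw (\<lambda>z. (map concat z, map (map length) z)) (word_comps2 w)
     (SIGMA x:word_comps w. word_comps (map length x))"
  unfolding bij_betw_def
proof (intro conjI subset_antisym subsetI)
  have "z = z'" if "map concat z = map concat z'" "map (map length) z = map (map length) z'"
    for z z' :: "nat list list list"
    using that by (induction z z' rule: list_induct2') (auto intro: concat_map_length_inject)
  then show "inj_on (\<lambda>z. (map concat z, map (map length) z)) (word_comps2 w)"
    by (auto intro!: inj_onI)
next
  fix p assume "p \<in> (\<lambda>z. (map concat z, map (map length) z)) ` word_comps2 w"
  then obtain z where z: "z \<in> word_comps2 w" "p = (map concat z, map (map length) z)"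
    by blast
  have "concat m \<noteq> []" if "m \<in> set z" for m
    using that z(1) by (fastforce simp: word_comps2_def neq_Nil_conv)
  with z show "p \<in> (SIGMA x:word_comps w. word_comps (map length x))"
    by (auto simp: word_comps_def word_comps2_def length_concat o_def simp del: concat_eq_Nil_conv)
next
  fix p assume "p \<in> (SIGMA x:word_comps w. word_comps (map length x))"
  then obtain x y where p: "p = (x, y)" "x \<in> word_comps w" "y \<in> word_comps (map length x)"
    by blast
  then have "map sum_list y = map length x"
    by (simp add: word_comps_def)
  then have "length y = length x"
    by (rule map_eq_imp_length_eq)
  \<comment> \<open>Tree by tree, the branches of \<open>x\<close> are distributed in blocks whose
    lengths are the entries of the corresponding member of \<open>y\<close>; the equation between
    sums and lengths says that they fit.\<close>
  then have "\<exists>z. map concat z = x \<and> map (map length) z = y"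
    using \<open>map sum_list y = map length x\<close>
  proof (induction y x rule: list_induct2)
    case (Cons l ls u us)
    then obtain z where "map concat z = us" "map (map length) z = ls"
      by auto
    moreover obtain m where "concat m = u" "map length m = l"
      using Cons.prems by (auto elim: split_into_lengths)
    ultimately have "map concat (m # z) = u # us \<and> map (map length) (m # z) = l # ls"
      by simp
    then show ?case by (rule exI)
  qed simp
  then obtain z where z: "map concat z = x" "map (map length) z = y"
    by blast
  have "z \<in> word_comps2 w"
    using p(2,3) unfolding z[symmetric] by (auto simp: word_comps_def word_comps2_def)
  with p z show "p \<in> (\<lambda>z. (map concat z, map (map length) z)) ` word_comps2 w"
    by blast
qed

text \<open>Both sides are sums over the three-level forests \<open>z\<close>, and the arguments of
  \<open>f\<close> are the leafward, middle and root arities of \<open>z\<close>. The two bijections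
  describe the two ways of reaching these by cutting twice.\<close>

lemma sum_word_comps_coassoc:
  fixes f :: "nat list \<Rightarrow> nat list \<Rightarrow> nat list \<Rightarrow> 'a::comm_monoid_add"
  shows "(\<Sum>x\<in>word_comps w. \<Sum>y\<in>word_comps (concat x). f (concat y) (map length y) (map length x)) =
    (\<Sum>x\<in>word_comps w. \<Sum>y\<in>word_comps (map length x). f (concat x) (concat y) (map length y))"
proof -
  have "(\<Sum>x\<in>word_comps w. \<Sum>y\<in>word_comps (concat x). f (concat y) (map length y) (map length x)) =
      (\<Sum>(x, y)\<in>(SIGMA x:word_comps w. word_comps (concat x)).
        f (concat y) (map length y) (map length x))"
    by (simp add: sum.Sigma)
  also have "\<dots> = (\<Sum>z\<in>word_comps2 w. f (concat (concat z)) (map length (concat z)) (map length z))"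
    by (subst sum.reindex_bij_betw[OF bij_betw_word_comps2_lower, symmetric]) (simp add: o_def)
  also have "\<dots> = (\<Sum>(x, y)\<in>(SIGMA x:word_comps w. word_comps (map length x)).
        f (concat x) (concat y) (map length y))"
    by (subst sum.reindex_bij_betw[OF bij_betw_word_comps2_upper, symmetric])
      (simp add: o_def map_concat concat_concat)
  also have "\<dots> = (\<Sum>x\<in>word_comps w. \<Sum>y\<in>word_comps (map length x). f (concat x) (concat y) (map length y))"
    by (simp add: sum.Sigma)
  finally show ?thesis .
qed


section \<open>Bialgebras of words\<close>

text \<open>A common normal form for the two bialgebras of the theorem. The axioms and the
  isomorphism are proved once from it, so that each bialgebra only has to be brought into this form
  by an encoding of words as basis elements.\<close>

locale word_bialgebra =
  fixes A :: "'b bialg" and enc :: "nat list \<Rightarrow> 'b"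
  assumes inj_enc: "inj_on enc {w. 0 \<notin> set w}"
    and basis: "basis A = enc ` {w. 0 \<notin> set w}"
    and bmul: "\<lbrakk>0 \<notin> set v; 0 \<notin> set w\<rbrakk> \<Longrightarrow> bmul A (enc v) (enc w) = delta (enc (v @ w))"
    and bone: "bone A = delta (enc [])"
    and bcomul: "0 \<notin> set w \<Longrightarrow> bcomul A (enc w) =
      (\<Sum>t\<in>word_comps w. delta (enc (concat t), enc (map length t)))"
    and bcounit: "0 \<notin> set w \<Longrightarrow> bcounit A (enc w) = of_bool (set w \<subseteq> {1})"
begin

lemma mul_delta: "mul A (delta x) (delta y) = bmul A x y"
  by (simp add: mul_def)

sublocale bialgebra A
proof
  fix x assume "x \<in> basis A"
  then obtain w where w: "x = enc w" "0 \<notin> set w"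
    by (auto simp: basis)
  note pos = word_comps_positive
  show "bcomul A x \<in> span_on (basis A \<times> basis A)"
    using pos w by (auto simp: bcomul basis intro!: sum_in_span_on)
  show "mul A (bone A) (delta x) = delta x" "mul A (delta x) (bone A) = delta x"
    using w bmul[of "[]" w] bmul[of w "[]"] by (simp_all add: bone mul_delta)
  show "lin (\<lambda>(y, z). lin (\<lambda>(y', y''). delta (y', y'', z)) (bcomul A y)) (bcomul A x) =
      lin (\<lambda>(y, z). lin (\<lambda>(z', z''). delta (y, z', z'')) (bcomul A z)) (bcomul A x)"
    \<comment> \<open>The rules \<open>set_concat\<close> and \<open>set_map\<close> are switched
      off so that the positivity conditions keep the shape in which
      \<open>word_comps_positive\<close> provides them.\<close>
    using w pos
    by (simp add: bcomul lin_sum sum_word_comps_coassoc[where f = "\<lambda>a b c. delta (enc a, enc b, enc c)"]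
        del: set_concat set_map cong: sum.cong)
  \<comment> \<open>The counit is an indicator function, so it filters the sum down to the single
    forest with trivial leafward level.\<close>
  have "lin (\<lambda>(y, z). scale (bcounit A y) (delta z)) (bcomul A x) =
      (\<Sum>t\<in>word_comps w. if set (concat t) \<subseteq> {1} then delta (enc (map length t)) else 0)"
    using w pos by (auto simp: bcomul lin_sum bcounit simp del: set_concat set_map intro!: sum.cong)
  also have "\<dots> = (\<Sum>t\<in>{t \<in> word_comps w. set (concat t) \<subseteq> {1}}. delta (enc (map length t)))"
    by (intro sum.inter_filter[symmetric]) simp
  also have "\<dots> = delta x"
    unfolding word_comps_leaves_trivial[OF w(2)] using w by (simp add: o_def)
  finally show "lin (\<lambda>(y, z). scale (bcounit A y) (delta z)) (bcomul A x) = delta x" .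
  have "lin (\<lambda>(y, z). scale (bcounit A z) (delta y)) (bcomul A x) =
      (\<Sum>t\<in>word_comps w. if set (map length t) \<subseteq> {1} then delta (enc (concat t)) else 0)"
    using w pos by (auto simp: bcomul lin_sum bcounit simp del: set_concat set_map intro!: sum.cong)
  also have "\<dots> = (\<Sum>t\<in>{t \<in> word_comps w. set (map length t) \<subseteq> {1}}. delta (enc (concat t)))"
    by (intro sum.inter_filter[symmetric]) simp
  also have "\<dots> = delta x"
    unfolding word_comps_roots_trivial[OF w(2)] using w by simp
  finally show "lin (\<lambda>(y, z). scale (bcounit A z) (delta y)) (bcomul A x) = delta x" .
next
  fix x y assume "x \<in> basis A" "y \<in> basis A"
  then obtain v w where vw: "x = enc v" "0 \<notin> set v" "y = enc w" "0 \<notin> set w"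
    by (auto simp: basis)
  show "bmul A x y \<in> span_on (basis A)"
    using vw by (auto simp: bmul basis)
  show "lin_form (bcounit A) (bmul A x y) = bcounit A x * bcounit A y"
    using vw by (simp add: bmul bcounit)
  show "lin (bcomul A) (bmul A x y) = mul2 A (bcomul A x) (bcomul A y)"
    using vw word_comps_positive
    by (simp add: bmul bcomul mul2_def tensor_sum lin_sum sum_word_comps_append del: set_concat set_map
        cong: sum.cong)
next
  fix x y z assume "x \<in> basis A" "y \<in> basis A" "z \<in> basis A"
  then show "mul A (bmul A x y) (delta z) = mul A (delta x) (bmul A y z)"
    by (auto simp: basis bmul mul_delta)
qed (auto simp: bone basis bcomul bcounit)

end

text \<open>Basis elements that encode the same word are matched, and the structure formulas depend
  on the word alone.\<close>

lemma word_bialgebras_isomorphic: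
  assumes "word_bialgebra A enc" "word_bialgebra B enc'"
  shows "bialgebra_isomorphic A B"
proof -
  interpret A: word_bialgebra A enc by fact
  interpret B: word_bialgebra B enc' by fact
  define g where "g x = enc' (inv_into {w. 0 \<notin> set w} enc x)" for x
  have g: "g (enc w) = enc' w" if "0 \<notin> set w" for w
    using that A.inj_enc by (simp add: g_def)
  have "bij_betw g (basis A) (basis B)"
    unfolding bij_betw_def A.basis B.basis
    using B.inj_enc by (auto simp: inj_on_def g image_iff)
  moreover have "lin (\<lambda>x. delta (g x)) (bmul A x y) = mul B (delta (g x)) (delta (g y))"
    if "x \<in> basis A" "y \<in> basis A" for x y
    using that by (auto simp: A.basis A.bmul B.mul_delta B.bmul g)
  moreover have "lin (\<lambda>(y, z). tensor (delta (g y)) (delta (g z))) (bcomul A x) =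
      lin (bcomul B) (delta (g x))" if "x \<in> basis A" for x
    using that word_comps_positive
    by (auto simp: A.basis A.bcomul B.bcomul g lin_sum simp del: set_concat set_map intro!: sum.cong)
  moreover have "bcounit A x = lin_form (bcounit B) (delta (g x))" if "x \<in> basis A" for x
    using that by (auto simp: A.basis A.bcounit B.bcounit g)
  ultimately have "bialgebra_iso (\<lambda>x. delta (g x)) A B"
    by (simp add: bialgebra_iso_def bij_betw_lin_delta A.bone B.bone g)
  then show ?thesis
    using A.bialgebra_axioms B.bialgebra_axioms by (auto simp: bialgebra_isomorphic_def)
qed


section \<open>The noncommutative Faa di Bruno bialgebra\<close>

lemma delta_mult: "delta x * delta y = delta (x + y)"
  by (simp add: delta_def mult_single)

text \<open>The coefficients do not commute, so expanding the power yields one ordered monomial for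
  each list of \<open>k\<close> indices. The induction splits off the first factor.\<close>

lemma fps_nth_generic_F_power:
  "fps_nth (generic_F ^ k) n =
     (\<Sum>ns | length ns = k \<and> 0 \<notin> set ns \<and> sum_list ns = n. delta (ns, []))"
proof (induction k arbitrary: n)
  case 0
  have "{ns. length ns = 0 \<and> 0 \<notin> set ns \<and> sum_list ns = n} = (if n = 0 then {[]} else {})"
    by auto
  then show ?case
    by (simp add: delta_def zero_prod_def zero_list_def flip: single_one)
next
  case (Suc k)
  let ?C = "\<lambda>k n. {ns. length ns = k \<and> 0 \<notin> set ns \<and> sum_list ns = (n::nat)}"
  have fin: "finite (?C k n)" for k n
    by (rule finite_subset[OF _ finite_positive_lists[of n]]) auto
  have C: "?C (Suc k) n = (\<lambda>(i, ns). i # ns) ` (SIGMA i:{1..n}. ?C k (n - i))"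
    by (auto simp: image_iff length_Suc_conv)
  have "fps_nth (generic_F ^ Suc k) n =
      (\<Sum>i\<in>{0..n}. fps_nth generic_F i * (\<Sum>ns\<in>?C k (n - i). delta (ns, [])))"
    by (simp add: fps_mult_nth Suc.IH)
  \<comment> \<open>The term with \<open>i = 0\<close> vanishes because \<open>generic_F\<close> has
    no constant term; this restricts the letters to positive numbers.\<close>
  also have "\<dots> = (\<Sum>i\<in>{1..n}. \<Sum>ns\<in>?C k (n - i). delta (i # ns, []))"
    by (intro sum.mono_neutral_cong_right)
      (auto simp: generic_F_def sum_distrib_left delta_mult plus_list_def)
  also have "\<dots> = (\<Sum>ns\<in>?C (Suc k) n. delta (ns, []))"
    unfolding C using fin by (simp add: sum.reindex inj_on_def sum.Sigma split_def)
  finally show ?case .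
qed

text \<open>The factor from \<open>generic_G\<close> lives in the second tensor component and that
  from \<open>generic_F\<close> in the first, so each composition \<open>ns\<close> of length
  \<open>k\<close> contributes its monomial tensored with the letter \<open>k\<close>.\<close>

lemma fps_nth_generic_compose:
  "fps_nth (fps_compose generic_G generic_F) n = (\<Sum>ns\<in>comps n. delta (ns, [length ns]))"
proof -
  let ?C = "\<lambda>k. {ns \<in> comps n. length ns = k}"
  have "fps_nth (fps_compose generic_G generic_F) n =
      (\<Sum>k\<in>{0..n}. \<Sum>ns\<in>?C k. delta (ns, [length ns]))"
    unfolding fps_compose_nth
  proof (intro sum.cong refl)
    fix k
    show "fps_nth generic_G k * fps_nth (generic_F ^ k) n = (\<Sum>ns\<in>?C k. delta (ns, [length ns]))"
    proof (cases "k = 0")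
      case True
      then have "?C k = {}"
        by (auto simp: comps_def)
      with True show ?thesis
        by (simp only: sum.empty) (simp add: generic_G_def)
    next
      case False
      then have "?C k = {ns. length ns = k \<and> 0 \<notin> set ns \<and> sum_list ns = n}"
        by (auto simp: comps_def)
      with False show ?thesis
        by (simp add: fps_nth_generic_F_power generic_G_def sum_distrib_left delta_mult plus_list_def
            cong: sum.cong_simp)
    qed
  qed
  \<comment> \<open>A composition of \<open>n\<close> has at most \<open>n\<close> parts, so the
    finite range of \<open>k\<close> in the coefficient formula misses none.\<close>
  also have "\<dots> = (\<Sum>ns\<in>comps n. delta (ns, [length ns]))"
    by (intro sum.group finite_comps) (auto simp: comps_def dest: length_le_sum_list)
  finally show ?thesis .
qed

lemma word_bialgebra_nc_Faa_di_Bruno: "word_bialgebra nc_Faa_di_Bruno id"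
proof
  fix w :: "nat list"
  \<comment> \<open>Multiplying the one-letter formulas distributes into a choice of one composition
    for each letter, that is, an element of \<open>word_comps w\<close>.\<close>
  have "prod_list (map (\<lambda>n. fps_nth (fps_compose generic_G generic_F) n) w) =
      (\<Sum>t\<in>word_comps w. delta (concat t, map length t))"
  proof (induction w)
    case Nil
    have "1 = (delta ([], []) :: nat list \<times> nat list \<Rightarrow>\<^sub>0 rat)"
      by (metis delta_def single_one zero_list_def zero_prod_def)
    then show ?case by simp
  next
    case (Cons n w)
    then show ?case
      by (simp add: fps_nth_generic_compose sum_word_comps_Cons sum_product delta_mult plus_list_def)
  qed
  then show "bcomul nc_Faa_di_Bruno (id w) =
      (\<Sum>t\<in>word_comps w. delta (id (concat t), id (map length t)))"
    by (simp add: nc_Faa_di_Bruno_def)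
  have "prod_list (map (\<lambda>n. fps_nth fps_X n) w) = (of_bool (set w \<subseteq> {1}) :: rat)"
    by (induction w) auto
  then show "bcounit nc_Faa_di_Bruno (id w) = of_bool (set w \<subseteq> {1})"
    by (simp add: nc_Faa_di_Bruno_def)
  show "bone nc_Faa_di_Bruno = delta (id [])"
    using single_one[where 'a = "nat list" and 'b = rat]
    by (simp add: nc_Faa_di_Bruno_def delta_def zero_list_def)
qed (simp_all add: nc_Faa_di_Bruno_def delta_mult plus_list_def)


section \<open>Discrete groupoids\<close>

text \<open>A groupoid is essentially the set of its objects if every arrow is the unique endomorphism
  of its domain.\<close>
definition discrete :: "('o, 'a) grpd \<Rightarrow> bool" where
  "discrete G \<longleftrightarrow> bij_betw (Dom G) (Arr G) (Obj G) \<and> (\<forall>f\<in>Arr G. Cod G f = Dom G f)"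

text \<open>A stricter form in which arrows are literally objects; it is inherited by the
  constructions that make up the groupoids of simplices. Homotopy fibres store arrows as triples and
  only satisfy \<open>discrete\<close>, hence the two notions.\<close>

definition discrete_on :: "'o set \<Rightarrow> ('o, 'o) grpd \<Rightarrow> bool" where
  "discrete_on S G \<longleftrightarrow> Obj G = S \<and> Arr G = S \<and>
     (\<forall>x\<in>S. Dom G x = x \<and> Cod G x = x \<and> Ide G x = x \<and> Cmp G x x = x)"

lemma discrete_on_imp_discrete: "discrete_on S G \<Longrightarrow> discrete G"
  by (auto simp: discrete_on_def discrete_def bij_betw_def inj_on_def image_iff)

lemma discrete_obtain_arr:
  assumes "discrete G" "x \<in> Obj G"
  obtains f where "f \<in> Arr G" "Dom G f = x"
  using assms unfolding discrete_def bij_betw_def by (metis imageE)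

lemma iso_class_discrete:
  assumes "discrete G" "x \<in> Obj G"
  shows "iso_class G x = {x}"
proof -
  obtain f where "f \<in> Arr G" "Dom G f = x"
    using assms by (rule discrete_obtain_arr)
  then show ?thesis
    using assms by (auto simp: discrete_def iso_class_def)
qed

lemma pi0_discrete: "discrete G \<Longrightarrow> pi0 G = (\<lambda>x. {x}) ` Obj G"
  by (auto simp: pi0_def iso_class_discrete)

lemma rep_singleton [simp]: "rep {x} = x"
  by (simp add: rep_def)

lemma card_Aut_discrete:
  assumes "discrete G" "x \<in> Obj G"
  shows "card (Aut G x) = 1"
proof -
  obtain f where "f \<in> Arr G" "Dom G f = x"
    using assms by (rule discrete_obtain_arr)
  with assms have "Aut G x = {f}"
    by (auto simp: Aut_def discrete_def bij_betw_def dest: inj_onD)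
  then show ?thesis by simp
qed

lemma hcard_discrete: "discrete G \<Longrightarrow> hcard G = of_nat (card (Obj G))"
  by (simp add: hcard_def pi0_discrete sum.reindex inj_on_def card_Aut_discrete)

text \<open>The only arrow into \<open>b\<close> is its identity, encoded as \<open>b\<close>
  itself, so the homotopy fibre is the strict fibre. The source is only required to be
  \<open>discrete\<close>, since in \<open>Phi\<close> it is itself a homotopy fibre.\<close>

lemma hfib_discrete:
  assumes G: "discrete G" and H: "discrete_on S H"
    and F: "\<And>x. x \<in> Obj G \<Longrightarrow> on_obj F x \<in> S"
      "\<And>g. g \<in> Arr G \<Longrightarrow> on_arr F g = on_obj F (Dom G g)"
  shows "discrete (hfib G H F b)"
    and "Obj (hfib G H F b) = (\<lambda>x. (x, b)) ` {x \<in> Obj G. on_obj F x = b}"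
proof -
  show obj: "Obj (hfib G H F b) = (\<lambda>x. (x, b)) ` {x \<in> Obj G. on_obj F x = b}"
    using H F by (auto simp: hfib_def Let_def discrete_on_def)
  let ?E = "(\<lambda>x. (x, b)) ` {x \<in> Obj G. on_obj F x = b}"
  have "Arr (hfib G H F b) = {(p, g, q). p \<in> ?E \<and> q \<in> ?E \<and> g \<in> Arr G \<and> Dom G g = fst p \<and>
      Cod G g = fst q \<and> Cmp H (snd q) (on_arr F g) = snd p}"
    unfolding obj[symmetric] by (simp add: hfib_def Let_def)
  \<comment> \<open>Arrows of \<open>G\<close> are endomorphisms and all objects of the fibre share
    the second component \<open>b\<close>, which forces \<open>q = p\<close>.\<close>
  also have "\<dots> = {(p, g, q). p \<in> ?E \<and> q = p \<and> g \<in> Arr G \<and> Dom G g = fst p}"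
  proof -
    have "(p \<in> ?E \<and> q \<in> ?E \<and> g \<in> Arr G \<and> Dom G g = fst p \<and>
        Cod G g = fst q \<and> Cmp H (snd q) (on_arr F g) = snd p) \<longleftrightarrow>
      (p \<in> ?E \<and> q = p \<and> g \<in> Arr G \<and> Dom G g = fst p)" for p g q
    proof
      assume *: "p \<in> ?E \<and> q \<in> ?E \<and> g \<in> Arr G \<and> Dom G g = fst p \<and>
        Cod G g = fst q \<and> Cmp H (snd q) (on_arr F g) = snd p"
      then have "fst q = fst p"
        using G by (metis discrete_def)
      moreover have "snd q = snd p"
        using * by auto
      ultimately show "p \<in> ?E \<and> q = p \<and> g \<in> Arr G \<and> Dom G g = fst p"
        using * by (simp add: prod_eq_iff)
    next
      assume *: "p \<in> ?E \<and> q = p \<and> g \<in> Arr G \<and> Dom G g = fst p"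
      then obtain x where x: "p = (x, b)" "x \<in> Obj G" "on_obj F x = b"
        by blast
      then have "on_arr F g = b" "Cmp H b b = b"
        using * F H by (auto simp: discrete_on_def)
      then show "p \<in> ?E \<and> q \<in> ?E \<and> g \<in> Arr G \<and> Dom G g = fst p \<and>
          Cod G g = fst q \<and> Cmp H (snd q) (on_arr F g) = snd p"
        using * x G by (simp add: discrete_def)
    qed
    then show ?thesis
      by (simp only:)
  qed
  finally have arr: "Arr (hfib G H F b) = \<dots>" .
  have "inj_on (Dom (hfib G H F b)) (Arr (hfib G H F b))"
    using G unfolding arr by (auto simp: inj_on_def hfib_def Let_def discrete_def bij_betw_def)
  moreover have "Dom (hfib G H F b) ` Arr (hfib G H F b) = ?E"
  proof -
    have "p \<in> Dom (hfib G H F b) ` Arr (hfib G H F b)" if p: "p \<in> ?E" for p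
    proof -
      have "fst p \<in> Obj G"
        using p by auto
      with G obtain g where "g \<in> Arr G" "Dom G g = fst p"
        by (rule discrete_obtain_arr)
      then have "(p, g, p) \<in> Arr (hfib G H F b)"
        using p unfolding arr by simp
      moreover have "Dom (hfib G H F b) (p, g, p) = p"
        by (simp add: hfib_def Let_def)
      ultimately show ?thesis
        by (metis image_eqI)
    qed
    moreover have "Dom (hfib G H F b) f \<in> ?E" if "f \<in> Arr (hfib G H F b)" for f
      using that unfolding arr by (auto simp: hfib_def Let_def)
    ultimately show ?thesis
      by blast
  qed
  moreover have "Cod (hfib G H F b) f = Dom (hfib G H F b) f" if "f \<in> Arr (hfib G H F b)" for f
    using that unfolding arr by (auto simp: hfib_def Let_def)
  ultimately show "discrete (hfib G H F b)"
    by (simp add: discrete_def bij_betw_def obj)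
qed

lemma hcard_hfib_discrete:
  assumes "discrete G" "discrete_on S H"
    and "\<And>x. x \<in> Obj G \<Longrightarrow> on_obj F x \<in> S"
      "\<And>g. g \<in> Arr G \<Longrightarrow> on_arr F g = on_obj F (Dom G g)"
  shows "hcard (hfib G H F b) = of_nat (card {x \<in> Obj G. on_obj F x = b})"
  using hfib_discrete[of G S H F b] assms
  by (simp add: hcard_discrete card_image inj_on_def)

section \<open>Discreteness under the constructions used for simplices, and incidence coefficients
  as counts\<close>

lemma discrete_on_prod:
  assumes "discrete_on S G" "discrete_on T H"
  shows "discrete_on (S \<times> T) (prod_grpd G H)"
  using assms by (auto simp: discrete_on_def prod_grpd_def)

lemma discrete_on_pullback:
  assumes "discrete_on S G" "discrete_on T H" "on_arr F = on_obj F" "on_arr K = on_obj K"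
  shows "discrete_on {(x, y). x \<in> S \<and> y \<in> T \<and> on_obj F x = on_obj K y} (pullback_grpd G F K H)"
  using assms by (auto simp: discrete_on_def prod_grpd_def pullback_grpd_def)

lemma discrete_on_Mr:
  assumes "discrete_on S G"
  shows "discrete_on {xs. xs \<noteq> [] \<and> set xs \<subseteq> S} (Mr G)"
proof -
  have "map2 (Cmp G) xs xs = xs" if "set xs \<subseteq> S" for xs
    using that assms by (induction xs) (auto simp: discrete_on_def)
  then show ?thesis
    using assms by (auto simp: discrete_on_def Mr_def subset_iff intro!: map_idI)
qed

lemma discrete_on_relabel:
  assumes "discrete_on S G" "\<And>x. f' (f x) = x"
  shows "discrete_on (f ` S) (relabel f f' f f' G)"
  using assms by (auto simp: discrete_on_def relabel_def)

text \<open>Both nested homotopy fibres are strict and the automorphism groups are trivial, so the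
  coefficient counts the 2-simplices with the three prescribed faces.\<close>

lemma incidence_coeff_discrete:
  fixes X :: "('o, 'o) sgrpd"
  assumes X1: "discrete_on S1 (spl X 1)" and X2: "discrete_on S2 (spl X 2)"
    and faces: "\<And>i x. i \<le> 2 \<Longrightarrow> x \<in> S2 \<Longrightarrow> on_obj (face X 2 i) x \<in> S1"
      "\<And>i. on_arr (face X 2 i) = on_obj (face X 2 i)"
    and ab: "a \<in> S1" "b \<in> S1"
  shows "incidence_coeff X f a b = of_nat (card {x \<in> S2. on_obj (face X 2 1) x = f \<and>
     on_obj (face X 2 2) x = a \<and> on_obj (face X 2 0) x = b})"
proof -
  have X2': "discrete (spl X 2)" "Obj (spl X 2) = S2" "\<And>g. g \<in> Arr (spl X 2) \<Longrightarrow> Dom (spl X 2) g = g"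
    using X2 discrete_on_imp_discrete by (auto simp: discrete_on_def)
  have fib: "discrete (fib_d1 X f)"
    "Obj (fib_d1 X f) = (\<lambda>x. (x, f)) ` {x \<in> S2. on_obj (face X 2 1) x = f}"
    using hfib_discrete[OF X2'(1) X1, of "face X 2 1" f] X2' faces
    by (simp_all add: fib_d1_def)
  \<comment> \<open>\<open>d2_d0\<close> reads the first component of an object but the middle
    component of an arrow; these agree because the arrows of \<open>X_2\<close> are its
    objects.\<close>
  have arr: "fst (Dom (fib_d1 X f) g) = fst (snd g)" if "g \<in> Arr (fib_d1 X f)" for g
    using that X2' by (auto simp: fib_d1_def hfib_def Let_def)
  have "hcard (Phi X f a b) = of_nat (card {p \<in> Obj (fib_d1 X f). on_obj (d2_d0 X) p = (a, b)})"
    unfolding Phi_def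
  proof (rule hcard_hfib_discrete[OF fib(1) discrete_on_prod[OF X1 X1]])
    show "on_obj (d2_d0 X) p \<in> S1 \<times> S1" if "p \<in> Obj (fib_d1 X f)" for p
      using that faces by (auto simp: fib d2_d0_def)
    show "on_arr (d2_d0 X) g = on_obj (d2_d0 X) (Dom (fib_d1 X f) g)"
      if "g \<in> Arr (fib_d1 X f)" for g
      using arr[OF that] by (simp add: d2_d0_def split_def faces)
  qed
  also have "{p \<in> Obj (fib_d1 X f). on_obj (d2_d0 X) p = (a, b)} = (\<lambda>x. (x, f)) `
      {x \<in> S2. on_obj (face X 2 1) x = f \<and> on_obj (face X 2 2) x = a \<and> on_obj (face X 2 0) x = b}"
    by (auto simp: fib d2_d0_def)
  finally show ?thesis
    using X1 ab card_Aut_discrete[OF discrete_on_imp_discrete[OF X1]]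
    by (simp add: incidence_coeff_def card_image inj_on_def discrete_on_def del: One_nat_def)
qed

text \<open>The fibre of \<open>d_1\<close> over \<open>f\<close> is grouped by the pair of outer
  faces, and each coefficient is the size of a group. Finiteness of the fibre ensures that a
  nonempty group has nonzero \<open>card\<close>.\<close>

lemma incidence_comul_discrete:
  fixes X :: "('o, 'o) sgrpd"
  assumes X1: "discrete_on S1 (spl X 1)" and X2: "discrete_on S2 (spl X 2)"
    and faces: "\<And>i x. i \<le> 2 \<Longrightarrow> x \<in> S2 \<Longrightarrow> on_obj (face X 2 i) x \<in> S1"
      "\<And>i. on_arr (face X 2 i) = on_obj (face X 2 i)"
    and fin: "finite {x \<in> S2. on_obj (face X 2 1) x = f}"
  shows "incidence_comul X {f} = (\<Sum>x | x \<in> S2 \<and> on_obj (face X 2 1) x = f.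
     delta ({on_obj (face X 2 2) x}, {on_obj (face X 2 0) x}))"
proof -
  let ?D = "{x \<in> S2. on_obj (face X 2 1) x = f}"
  let ?d = "\<lambda>x. ({on_obj (face X 2 2) x}, {on_obj (face X 2 0) x})"
  have pi0: "pi0 (spl X 1) = (\<lambda>x. {x}) ` S1"
    using pi0_discrete[OF discrete_on_imp_discrete[OF X1]] X1 by (simp add: discrete_on_def)
  have coeff: "incidence_coeff X f (rep a) (rep b) = of_nat (card {x \<in> ?D. ?d x = (a, b)})"
    if comps: "a \<in> pi0 (spl X 1)" "b \<in> pi0 (spl X 1)" for a b
  proof -
    obtain x y where "a = {x}" "b = {y}" "x \<in> S1" "y \<in> S1"
      using comps unfolding pi0 by blast
    then show ?thesis
      using incidence_coeff_discrete[OF X1 X2 faces, of x y f] by (simp add: conj_assoc)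
  qed
  let ?K = "{(a, b). a \<in> pi0 (spl X 1) \<and> b \<in> pi0 (spl X 1) \<and>
      incidence_coeff X (rep {f}) (rep a) (rep b) \<noteq> 0}"
  \<comment> \<open>The pairs with nonzero coefficient are exactly those attained as outer faces on
    the fibre.\<close>
  have K: "?K = ?d ` ?D"
  proof (intro subset_antisym subrelI)
    fix a b assume "(a, b) \<in> ?K"
    then have "card {x \<in> ?D. ?d x = (a, b)} \<noteq> 0"
      using coeff by auto
    then have "{x \<in> ?D. ?d x = (a, b)} \<noteq> {}"
      by (metis card.empty)
    then show "(a, b) \<in> ?d ` ?D"
      by auto
  next
    fix a b assume ab: "(a, b) \<in> ?d ` ?D"
    then have "{x \<in> ?D. ?d x = (a, b)} \<noteq> {}"
      by auto
    moreover have "finite {x \<in> ?D. ?d x = (a, b)}"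
      using fin by (rule finite_subset[rotated]) blast
    ultimately have "card {x \<in> ?D. ?d x = (a, b)} \<noteq> 0"
      by (simp only: card_0_eq not_False_eq_True)
    moreover have "a \<in> pi0 (spl X 1)" "b \<in> pi0 (spl X 1)"
      using ab faces(1) unfolding pi0 by auto
    ultimately show "(a, b) \<in> ?K"
      using coeff by simp
  qed
  have "incidence_comul X {f} = (\<Sum>c\<in>?K. \<Sum>x\<in>{x \<in> ?D. ?d x = c}. delta (?d x))"
    unfolding incidence_comul_def
  proof (intro sum.cong refl)
    fix c assume "c \<in> ?K"
    then obtain a b where c: "c = (a, b)" and "a \<in> pi0 (spl X 1)" "b \<in> pi0 (spl X 1)"
      by blast
    then have "incidence_coeff X (rep {f}) (rep a) (rep b) = of_nat (card {x \<in> ?D. ?d x = (a, b)})"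
      by (simp add: coeff)
    moreover have "scale (of_nat (card I)) (delta (a, b)) = (\<Sum>x\<in>I. delta (a, b))" for I :: "'o set"
      by (induction I rule: infinite_finite_induct) (simp_all add: scale_add_left)
    ultimately show "(case c of (a, b) \<Rightarrow>
        scale (incidence_coeff X (rep {f}) (rep a) (rep b)) (delta (a, b))) =
        (\<Sum>x\<in>{x \<in> ?D. ?d x = c}. delta (?d x))"
      by (simp add: c cong: sum.cong_simp)
  qed
  also have "\<dots> = (\<Sum>x\<in>?D. delta (?d x))"
    unfolding K using fin by (intro sum.group) auto
  finally show ?thesis .
qed


section \<open>The bar construction of the associative operad\<close>

definition op :: "nat \<Rightarrow> (unit, unit list) tree" where
  "op n = Oper (replicate n ())"

text \<open>The root arity is forced: with a single colour, the matching of outputs and inputs only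
  says that there are as many branches as root inputs.\<close>

definition corolla2 :: "nat list \<Rightarrow> (unit, unit list) tree" where
  "corolla2 ns = Node (map op ns, replicate (length ns) ())"

lemma unit_list_eq: "xs = replicate (length xs) ()"
  by (induction xs) auto

lemma op_inject [simp]: "op m = op n \<longleftrightarrow> m = n"
  by (metis length_replicate op_def tree.inject(2))

lemma the_oper_op [simp]: "the_oper (op n) = replicate n ()"
  by (simp add: op_def)

lemma inj_op: "inj op"
  by (simp add: inj_def)

lemma inj_corolla2: "inj corolla2"
  by (auto simp: inj_def corolla2_def inj_map_eq_map[OF inj_op])

lemma discrete_on_one: "discrete_on {()} one_grpd"
  by (simp add: discrete_on_def one_grpd_def)

lemma Ass_simps [simp]:
  "colours Ass = one_grpd" "opers Ass = Mr one_grpd"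
  "on_obj (src Ass) = id" "on_arr (src Ass) = id"
  "on_obj (tgt Ass) = (\<lambda>_. ())" "on_arr (tgt Ass) = (\<lambda>_. ())"
  "on_obj (cmpn Ass) = (\<lambda>(xs, _). concat xs)" "on_arr (cmpn Ass) = (\<lambda>(xs, _). concat xs)"
  "on_obj (unt Ass) = (\<lambda>x. [x])" "on_arr (unt Ass) = (\<lambda>x. [x])"
  by (simp_all add: Ass_def Mr_mult_def Mr_unit_def)

section \<open>Simplices of the bar construction in degrees 0 to 2\<close>

lemma discrete_on_trees_0: "discrete_on {Colour ()} (trees Ass 0)"
  using discrete_on_relabel[OF discrete_on_one, of the_colour Colour] by simp

lemma discrete_on_trees_1: "discrete_on (op ` {0<..}) (trees Ass (Suc 0))"
proof -
  have "Oper ` {xs. xs \<noteq> [] \<and> set xs \<subseteq> {()}} = op ` {0<..}"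
  proof (intro subset_antisym subsetI)
    fix x :: "(unit, unit list) tree" assume "x \<in> Oper ` {xs. xs \<noteq> [] \<and> set xs \<subseteq> {()}}"
    then obtain xs where "x = Oper xs" "xs \<noteq> []" by blast
    then have "x = op (length xs)" "0 < length xs"
      using unit_list_eq by (auto simp: op_def)
    then show "x \<in> op ` {0<..}" by blast
  qed (auto simp: op_def)
  moreover have "discrete_on (Oper ` {xs. xs \<noteq> [] \<and> set xs \<subseteq> {()}}) (trees Ass (Suc 0))"
    unfolding trees.simps Ass_simps
    by (intro discrete_on_relabel discrete_on_Mr discrete_on_one) simp
  ultimately show ?thesis
    by (simp only:)
qed

lemma discrete_on_trees_2: "discrete_on (corolla2 ` {ns. ns \<noteq> [] \<and> 0 \<notin> set ns}) (trees Ass (Suc (Suc 0)))"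
proof -
  let ?P = "{(x, y). x \<in> {xs. xs \<noteq> [] \<and> set xs \<subseteq> op ` {0<..}} \<and> y \<in> {xs. xs \<noteq> [] \<and> set xs \<subseteq> {()}} \<and>
      on_obj (Mr_map (tree_out_functor Ass)) x = on_obj (src Ass) y}"
  have "discrete_on (Node ` ?P) (trees Ass (Suc (Suc 0)))"
    unfolding trees.simps(3)
    by (intro discrete_on_relabel discrete_on_pullback)
      (use discrete_on_Mr[OF discrete_on_trees_1] discrete_on_Mr[OF discrete_on_one] in
        \<open>auto simp: Mr_map_def tree_out_functor_def simp del: trees.simps(2)\<close>)
  moreover have "Node ` ?P = corolla2 ` {ns. ns \<noteq> [] \<and> 0 \<notin> set ns}"
  proof (intro subset_antisym subsetI)
    fix x assume "x \<in> Node ` ?P"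
    then obtain xs r where x: "x = Node (xs, r)" "xs \<noteq> []" "set xs \<subseteq> op ` {0<..}"
      "map (tree_out (\<lambda>_. ())) xs = r"
      by (auto simp: Mr_map_def tree_out_functor_def)
    then obtain ns where ns: "xs = map op ns" "set ns \<subseteq> {0<..}"
      by (metis lists_image lists_eq_set imageE mem_Collect_eq)
    moreover have "r = replicate (length ns) ()"
      using x(4) ns unit_list_eq[of r] by auto
    ultimately show "x \<in> corolla2 ` {ns. ns \<noteq> [] \<and> 0 \<notin> set ns}"
      using x by (auto simp: corolla2_def)
  next
    fix x assume "x \<in> corolla2 ` {ns. ns \<noteq> [] \<and> 0 \<notin> set ns}"
    then obtain ns where x: "x = corolla2 ns" "ns \<noteq> []" "0 \<notin> set ns"
      by blast
    moreover have "map (\<lambda>_. ()) ns = replicate (length ns) ()"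
      by (simp add: map_replicate_const)
    ultimately show "x \<in> Node ` ?P"
      by (auto simp: corolla2_def Mr_map_def tree_out_functor_def op_def o_def intro!: imageI
          gr0I split: prod.splits)
  qed
  ultimately show ?thesis by simp
qed

lemma nonempty_lists_image: "{xs. xs \<noteq> [] \<and> set xs \<subseteq> f ` A} = map f ` {xs. xs \<noteq> [] \<and> set xs \<subseteq> A}"
proof -
  have "{xs. set xs \<subseteq> f ` A} = map f ` {xs. set xs \<subseteq> A}"
    using lists_image[of f A] by (simp add: lists_eq_set)
  then show ?thesis
    by (auto simp: set_eq_iff image_iff)
qed

lemma discrete_on_bar_0: "discrete_on {xs. xs \<noteq> [] \<and> set xs \<subseteq> {Colour ()}} (spl (bar Ass) 0)"
  using discrete_on_Mr[OF discrete_on_trees_0] by (simp add: bar_def)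

lemma discrete_on_bar_1: "discrete_on (map op ` {w. w \<noteq> [] \<and> 0 \<notin> set w}) (spl (bar Ass) 1)"
proof -
  have "{w. w \<noteq> [] \<and> set w \<subseteq> {0<..}} = {w. w \<noteq> [] \<and> (0::nat) \<notin> set w}"
    by (auto intro: gr0I)
  then show ?thesis
    using discrete_on_Mr[OF discrete_on_trees_1]
    by (simp add: bar_def nonempty_lists_image del: trees.simps)
qed

lemma discrete_on_bar_2:
  "discrete_on (map corolla2 ` {t. t \<noteq> [] \<and> (\<forall>ns\<in>set t. ns \<noteq> [] \<and> 0 \<notin> set ns)}) (spl (bar Ass) 2)"
proof -
  have "{t. t \<noteq> [] \<and> set t \<subseteq> {ns. ns \<noteq> [] \<and> (0::nat) \<notin> set ns}} =
      {t. t \<noteq> [] \<and> (\<forall>ns\<in>set t. ns \<noteq> [] \<and> 0 \<notin> set ns)}"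
    by blast
  then show ?thesis
    using discrete_on_Mr[OF discrete_on_trees_2]
    by (simp add: bar_def nonempty_lists_image numeral_2_eq_2 del: trees.simps)
qed

text \<open>Composition in \<open>Ass\<close> concatenates lists of units, so arities add up; this
  is where the sums in \<open>d_1\<close> come from.\<close>

lemma face_bar_2:
  "on_obj (face (bar Ass) 2 0) (map corolla2 t) = map op (map length t)"
  "on_obj (face (bar Ass) 2 1) (map corolla2 t) = map op (map sum_list t)"
  "on_obj (face (bar Ass) 2 2) (map corolla2 t) = map op (concat t)"
proof -
  have "concat (map (\<lambda>n. replicate n ()) ns) = replicate (sum_list ns) ()" for ns
    by (induction ns) (simp_all add: replicate_add)
  then show "on_obj (face (bar Ass) 2 1) (map corolla2 t) = map op (map sum_list t)"
    by (simp add: bar_def seq_face_def corolla2_def numeral_2_eq_2 o_def) (simp add: op_def)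
qed (simp_all add: bar_def seq_face_def corolla2_def numeral_2_eq_2 op_def map_concat o_def)

section \<open>Comultiplication and counit of the bar construction\<close>

lemma incidence_comul_bar:
  assumes "w \<noteq> []"
  shows "incidence_comul (bar Ass) {map op w} =
    (\<Sum>t\<in>word_comps w. delta ({map op (concat t)}, {map op (map length t)}))"
proof -
  let ?S2 = "map corolla2 ` {t. t \<noteq> [] \<and> (\<forall>ns\<in>set t. ns \<noteq> [] \<and> 0 \<notin> set ns)}"
  \<comment> \<open>As \<open>w\<close> is nonempty, every forest over it is nonempty and hence a
    simplex.\<close>
  have fib: "{x \<in> ?S2. on_obj (face (bar Ass) 2 1) x = map op w} = map corolla2 ` word_comps w"
    using assms by (auto simp: face_bar_2 word_comps_def inj_map_eq_map[OF inj_op] simp del: map_map One_nat_def)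
  have "incidence_comul (bar Ass) {map op w} =
      (\<Sum>x\<in>map corolla2 ` word_comps w.
        delta ({on_obj (face (bar Ass) 2 2) x}, {on_obj (face (bar Ass) 2 0) x}))"
    unfolding fib[symmetric]
  proof (rule incidence_comul_discrete[OF discrete_on_bar_1 discrete_on_bar_2])
    show "on_obj (face (bar Ass) 2 i) x \<in> map op ` {w. w \<noteq> [] \<and> 0 \<notin> set w}"
      if i: "i \<le> 2" and x: "x \<in> ?S2" for i x
    proof -
      obtain t where t: "x = map corolla2 t" "t \<noteq> []" "\<forall>ns\<in>set t. ns \<noteq> [] \<and> 0 \<notin> set ns"
        using x by blast
      have "i = 0 \<or> i = 1 \<or> i = 2"
        using i by auto
      moreover have "0 \<notin> set (map length t)" "0 \<notin> set (map sum_list t)" "0 \<notin> set (concat t)"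
          "concat t \<noteq> []"
        using t by (fastforce simp: neq_Nil_conv)+
      ultimately show ?thesis
        using t by (auto simp: face_bar_2 simp del: map_map set_map set_concat One_nat_def intro!: imageI)
    qed
    show "on_arr (face (bar Ass) 2 i) = on_obj (face (bar Ass) 2 i)" for i
      by (simp add: bar_def)
    show "finite {x \<in> ?S2. on_obj (face (bar Ass) 2 1) x = map op w}"
      unfolding fib by simp
  qed
  also have "\<dots> = (\<Sum>t\<in>word_comps w. delta ({map op (concat t)}, {map op (map length t)}))"
    by (simp add: sum.reindex inj_on_def inj_map_eq_map[OF inj_corolla2] face_bar_2 del: map_map)
  finally show ?thesis .
qed

text \<open>The degeneracy turns a sequence of colours into equally many unary operations. Its fibre
  over \<open>w\<close> is therefore one sequence of length \<open>length w\<close> if all letters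
  are 1, and empty otherwise.\<close>

lemma incidence_counit_bar:
  assumes "w \<noteq> []"
  shows "incidence_counit (bar Ass) {map op w} = of_bool (set w \<subseteq> {1})"
proof -
  let ?S0 = "{xs :: (unit, unit list) tree list. xs \<noteq> [] \<and> set xs \<subseteq> {Colour ()}}"
  let ?s = "on_obj (degen (bar Ass) 0 0)"
  have s: "?s x = map op (replicate (length x) 1)" if x: "x \<in> ?S0" for x
  proof -
    obtain n where "x = replicate n (Colour ())"
      using x replicate_eqI[of x "length x" "Colour ()"] by blast
    then show ?thesis
      by (simp add: bar_def op_def)
  qed
  have S1: "?s x \<in> map op ` {w. w \<noteq> [] \<and> 0 \<notin> set w}" if "x \<in> ?S0" for x
    unfolding s[OF that] using that by (intro imageI) auto
  have X0: "discrete (spl (bar Ass) 0)" "Obj (spl (bar Ass) 0) = ?S0"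
    using discrete_on_imp_discrete[OF discrete_on_bar_0] discrete_on_bar_0
    by (simp_all add: discrete_on_def)
  have "incidence_counit (bar Ass) {map op w} = of_nat (card {x \<in> ?S0. ?s x = map op w})"
    unfolding incidence_counit_def rep_singleton X0(2)[symmetric]
  proof (rule hcard_hfib_discrete[OF X0(1) discrete_on_bar_1])
    show "on_arr (degen (bar Ass) 0 0) g = ?s (Dom (spl (bar Ass) 0) g)"
      if "g \<in> Arr (spl (bar Ass) 0)" for g
      using that discrete_on_bar_0 by (simp add: discrete_on_def) (simp add: bar_def)
  qed (use S1 X0 in simp)
  also have "{x \<in> ?S0. ?s x = map op w} =
      (if set w \<subseteq> {1} then {replicate (length w) (Colour ())} else {})"
  proof -
    have "{x \<in> ?S0. ?s x = map op w} = {x \<in> ?S0. replicate (length x) 1 = w}"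
      using s by (auto simp: inj_map_eq_map[OF inj_op] simp del: map_replicate)
    also have "\<dots> = {x. x = replicate (length w) (Colour ()) \<and> replicate (length w) 1 = w}"
    proof (intro Collect_cong iffI)
      fix x assume x: "x \<in> ?S0 \<and> replicate (length x) 1 = w"
      then have "x = replicate (length x) (Colour ())"
        using replicate_eqI[of x "length x" "Colour ()"] by blast
      moreover have "length w = length x"
        using x by (metis length_replicate)
      ultimately show "x = replicate (length w) (Colour ()) \<and> replicate (length w) 1 = w"
        using x by simp
    next
      fix x :: "(unit, unit list) tree list"
      assume "x = replicate (length w) (Colour ()) \<and> replicate (length w) 1 = w"
      then show "x \<in> ?S0 \<and> replicate (length x) 1 = w"
        using assms by simp
    qed
    also have "replicate (length w) 1 = w \<longleftrightarrow> set w \<subseteq> {1}"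
    proof
      assume "replicate (length w) 1 = w"
      then have "set w = set (replicate (length w) 1)"
        by simp
      also have "\<dots> \<subseteq> {1}"
        by (simp add: set_replicate_conv_if)
      finally show "set w \<subseteq> {1}" .
    next
      assume "set w \<subseteq> {1}"
      then show "replicate (length w) 1 = w"
        using replicate_eqI[of w "length w" 1] by fastforce
    qed
    finally show ?thesis by simp
  qed
  finally show ?thesis by simp
qed

text \<open>Simplices are nonempty tuples, so the empty word must go to the adjoined unit
  \<open>None\<close>; other isomorphism classes are singletons by discreteness.\<close>

definition word_class :: "nat list \<Rightarrow> (unit, unit list) tree list set option" where
  "word_class w = (if w = [] then None else Some {map op w})"

lemma word_bialgebra_incidence_bar: "word_bialgebra (incidence_bialgebra (bar Ass)) word_class"
proof
  have X1: "discrete (spl (bar Ass) 1)" "Obj (spl (bar Ass) 1) = map op ` {w. w \<noteq> [] \<and> 0 \<notin> set w}"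
    using discrete_on_imp_discrete[OF discrete_on_bar_1] discrete_on_bar_1
    by (simp_all add: discrete_on_def)
  show "inj_on word_class {w. 0 \<notin> set w}"
    by (auto simp: inj_on_def word_class_def inj_map_eq_map[OF inj_op])
  show "basis (incidence_bialgebra (bar Ass)) = word_class ` {w. 0 \<notin> set w}"
  proof -
    have "word_class ` {w. w \<noteq> [] \<and> 0 \<notin> set w} = Some ` pi0 (spl (bar Ass) 1)"
      unfolding pi0_discrete[OF X1(1)] X1(2) image_image
      by (intro image_cong) (simp_all add: word_class_def)
    moreover have "{w. 0 \<notin> set w} = insert [] {w. w \<noteq> [] \<and> (0 :: nat) \<notin> set w}"
      by auto
    moreover have "word_class [] = None"
      by (simp add: word_class_def)
    ultimately show ?thesis
      by (simp add: incidence_bialgebra_def)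
  qed
  show "bone (incidence_bialgebra (bar Ass)) = delta (word_class [])"
    by (simp add: incidence_bialgebra_def word_class_def)
  show "bmul (incidence_bialgebra (bar Ass)) (word_class v) (word_class w) =
      delta (word_class (v @ w))" if "0 \<notin> set v" "0 \<notin> set w" for v w
  proof -
    have "map op v @ map op w \<in> Obj (spl (bar Ass) 1)" if "v \<noteq> []"
      unfolding X1(2) map_append[symmetric] using that \<open>0 \<notin> set v\<close> \<open>0 \<notin> set w\<close> by (intro imageI) simp
    then show ?thesis
      by (simp add: incidence_bialgebra_def word_class_def iso_class_discrete[OF X1(1)] del: One_nat_def)
  qed
  fix w :: "nat list" assume "0 \<notin> set w"
  show "bcomul (incidence_bialgebra (bar Ass)) (word_class w) =
      (\<Sum>t\<in>word_comps w. delta (word_class (concat t), word_class (map length t)))"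
  proof (cases "w = []")
    case False
    \<comment> \<open>Both outer faces of a nonempty forest are nonempty words, so no summand
      involves the adjoined unit.\<close>
    then have "word_class (concat t) = Some {map op (concat t)}"
        "word_class (map length t) = Some {map op (map length t)}" if "t \<in> word_comps w" for t
      using that by (auto simp: word_comps_def word_class_def neq_Nil_conv)
    with False show ?thesis
      by (simp add: incidence_bialgebra_def word_class_def[of w] incidence_comul_bar lin_sum
          del: map_map cong: sum.cong)
  qed (simp add: incidence_bialgebra_def word_class_def)
  show "bcounit (incidence_bialgebra (bar Ass)) (word_class w) = of_bool (set w \<subseteq> {1})"
    by (simp add: incidence_bialgebra_def word_class_def incidence_counit_bar)
qed

theorem theorem5p11:
  shows "bialgebra_isomorphic nc_Faa_di_Bruno (incidence_bialgebra (bar Ass))"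
  by (rule word_bialgebras_isomorphic[OF word_bialgebra_nc_Faa_di_Bruno word_bialgebra_incidence_bar])

end
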